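(* Let $B$ be a C*-algebra which has an AF-action. Then $B$ is singly generated, i.e., there is an element $b\in B$ such that $B=\mathrm{C}^*(b)$.
   Context: $\mathbb N=\{1,2,3,\dots\}$. For a subset $S$ of a C*-algebra, $\mathrm{C}^*(S)$ denotes the smallest C*-subalgebra containing $S$; a C*-algebra is singly generated if it equals $\mathrm{C}^*(b)$ for a single element $b$. Unital C*-subalgebras contain the unit of the ambient algebra. $[x,y]=xy-yx$. AF-action. Let $B$ be a unital C*-algebra containing a simple separable unital AF subalgebra $A$ and a separable unital C*-subalgebra $D$. Let $(\bigoplus_{1\le j\le K_i}\mathrm{M}_{n_{i,j}}(\mathbb C),\phi_i)_{i\in\mathbb N}$ be a canonical inductive limit decomposition of $A$ ($n_{i,j},K_i\in\mathbb N$): the $\phi_i$ are unital injective $*$-homomorphisms sending each canonical matrix unit to a sum of canonical matrix units (i.e. standard block-diagonal embeddings up to permutation of coordinates), and the finite-dimensional algebras are identified with their images in $A\subseteq B$. Let $V_{i,j}$ be the set of canonical matrix units of $\mathrm{M}_{n_{i,j}}(\mathbb C)$, and put $V=\bigcup_{i}\bigcup_{j=1}^{K_i}V_{i,j}$, $E_{i,j}=\{v\in V_{i,j}: v=v^*\}$, $D_0=\mathrm{C}^*\big(\bigcup_i\bigcup_{j=1}^{K_i}E_{i,j}\big)$. One says that $B$ has an AF-action (written $B=B(A,D)$) if (1) $B=\mathrm{C}^*(A,D)$; (2) $[d,d']=0$ for all $d\in D$, $d'\in D_0$; (3) $vdv^*\in D$ for all $d\in D$, $v\in V$.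
   Formalization: The formal theorem additionally assumes that the simple AF algebra A is infinite-dimensional; without this the claim fails, e.g. for A = ℂ and B = D = C([0,1]^3), which has an AF-action but is not singly generated. *)

theory Defs
  imports
    "HOL-Analysis.Analysis"
    "Jordan_Normal_Form.Schur_Decomposition"
begin

section \<open>Unital C*-algebras\<close>

text \<open>
  A nonzero unital C*-algebra is a type of the following class. The class
  \<^class>\<open>real_normed_algebra_1\<close> demands norm 1 = 1; for a nonzero algebra this already follows
  from the C*-identity.
\<close>

class unital_cstar_algebra = real_normed_algebra_1 + banach +
  fixes scaleC :: "complex \<Rightarrow> 'a \<Rightarrow> 'a" (infixr "*\<^sub>C" 75)
    and star :: "'a \<Rightarrow> 'a"
  assumes scaleR_scaleC: "scaleR r x = complex_of_real r *\<^sub>C x"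
    and scaleC_add_right: "c *\<^sub>C (x + y) = c *\<^sub>C x + c *\<^sub>C y"
    and scaleC_add_left: "(c + d) *\<^sub>C x = c *\<^sub>C x + d *\<^sub>C x"
    and scaleC_scaleC: "c *\<^sub>C d *\<^sub>C x = (c * d) *\<^sub>C x"
    and scaleC_one: "1 *\<^sub>C x = x"
    and mult_scaleC_left: "(c *\<^sub>C x) * y = c *\<^sub>C (x * y)"
    and mult_scaleC_right: "x * (c *\<^sub>C y) = c *\<^sub>C (x * y)"
    and norm_scaleC: "norm (c *\<^sub>C x) = cmod c * norm x"
    and star_add: "star (x + y) = star x + star y"
    and star_scaleC: "star (c *\<^sub>C x) = cnj c *\<^sub>C star x"
    and star_mult: "star (x * y) = star y * star x"
    and star_star: "star (star x) = x"
    and cstar_identity: "norm (star x * x) = (norm x)\<^sup>2"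

global_interpretation complex_vector:
  vector_space "scaleC :: complex \<Rightarrow> 'a \<Rightarrow> 'a::unital_cstar_algebra"
  by unfold_locales (simp_all add: scaleC_add_right scaleC_add_left scaleC_scaleC scaleC_one)

definition cstar_subalgebra :: "'a::unital_cstar_algebra set \<Rightarrow> bool" where
  "cstar_subalgebra S \<longleftrightarrow>
     complex_vector.subspace S \<and> closed S \<and>
     (\<forall>x\<in>S. \<forall>y\<in>S. x * y \<in> S) \<and> (\<forall>x\<in>S. star x \<in> S)"

definition unital_cstar_subalgebra :: "'a::unital_cstar_algebra set \<Rightarrow> bool" where
  "unital_cstar_subalgebra S \<longleftrightarrow> cstar_subalgebra S \<and> 1 \<in> S"

text \<open>The smallest C*-subalgebra containing a set; it need not contain the unit.\<close>

definition cstar_generated :: "'a::unital_cstar_algebra set \<Rightarrow> 'a set" where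
  "cstar_generated S = cstar_subalgebra hull S"

definition finite_dimensional :: "'a::unital_cstar_algebra set \<Rightarrow> bool" where
  "finite_dimensional S \<longleftrightarrow> (\<exists>X. finite X \<and> S \<subseteq> complex_vector.span X)"

definition closed_ideal :: "'a::unital_cstar_algebra set \<Rightarrow> 'a set \<Rightarrow> bool" where
  "closed_ideal A I \<longleftrightarrow>
     I \<subseteq> A \<and> complex_vector.subspace I \<and> closed I \<and>
     (\<forall>a\<in>A. \<forall>x\<in>I. a * x \<in> I \<and> x * a \<in> I)"

definition simple_cstar :: "'a::unital_cstar_algebra set \<Rightarrow> bool" where
  "simple_cstar A \<longleftrightarrow> A \<noteq> {0} \<and> (\<forall>I. closed_ideal A I \<longrightarrow> I = {0} \<or> I = A)"

definition AF_algebra :: "'a::unital_cstar_algebra set \<Rightarrow> bool" where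
  "AF_algebra A \<longleftrightarrow>
     (\<exists>F :: nat \<Rightarrow> 'a set.
        (\<forall>i. cstar_subalgebra (F i) \<and> finite_dimensional (F i) \<and> F i \<subseteq> F (Suc i)) \<and>
        A = closure (\<Union>i. F i))"


section \<open>Direct sums of full matrix algebras\<close>

record 'a star_algebra = "(complex, 'a) module" +
  adj :: "'a \<Rightarrow> 'a"

definition ambient_algebra :: "'a::unital_cstar_algebra star_algebra" where
  "ambient_algebra =
     \<lparr>carrier = UNIV, mult = (*), one = 1, zero = 0, add = (+), smult = scaleC, adj = star\<rparr>"

text \<open>
  The direct sum over j < K of the algebras of complex n j by n j matrices. Blocks, rows and
  columns are numbered from 0.
\<close>

definition matrix_sum :: "nat \<Rightarrow> (nat \<Rightarrow> nat) \<Rightarrow> (nat \<Rightarrow> complex mat) star_algebra" where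
  "matrix_sum K n =
     \<lparr>carrier = (\<Pi>\<^sub>E j\<in>{..<K}. carrier_mat (n j) (n j)),
      mult = (\<lambda>x y. \<lambda>j\<in>{..<K}. x j * y j),
      one = (\<lambda>j\<in>{..<K}. 1\<^sub>m (n j)),
      zero = (\<lambda>j\<in>{..<K}. 0\<^sub>m (n j) (n j)),
      add = (\<lambda>x y. \<lambda>j\<in>{..<K}. x j + y j),
      smult = (\<lambda>c x. \<lambda>j\<in>{..<K}. c \<cdot>\<^sub>m x j),
      adj = (\<lambda>x. \<lambda>j\<in>{..<K}. mat_adjoint (x j))\<rparr>"

definition matrix_unit :: "nat \<Rightarrow> (nat \<Rightarrow> nat) \<Rightarrow> nat \<Rightarrow> nat \<Rightarrow> nat \<Rightarrow> nat \<Rightarrow> complex mat" where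
  "matrix_unit K n j k l =
     (\<lambda>j'\<in>{..<K}. mat (n j') (n j')
        (\<lambda>(r, c). if j' = j \<and> r = k \<and> c = l then 1 else 0))"

definition block_units :: "nat \<Rightarrow> (nat \<Rightarrow> nat) \<Rightarrow> nat \<Rightarrow> (nat \<Rightarrow> complex mat) set" where
  "block_units K n j = {matrix_unit K n j k l | k l. k < n j \<and> l < n j}"

definition matrix_units :: "nat \<Rightarrow> (nat \<Rightarrow> nat) \<Rightarrow> (nat \<Rightarrow> complex mat) set" where
  "matrix_units K n = (\<Union>j<K. block_units K n j)"

text \<open>Ring homomorphisms in the sense of \<^const>\<open>Ring.ring_hom\<close> preserve the unit.\<close>

definition unital_star_hom ::
    "'a star_algebra \<Rightarrow> 'b star_algebra \<Rightarrow> ('a \<Rightarrow> 'b) set" where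
  "unital_star_hom G H =
     {f \<in> Ring.ring_hom G H.
        (\<forall>c. \<forall>x\<in>carrier G. f (c \<odot>\<^bsub>G\<^esub> x) = c \<odot>\<^bsub>H\<^esub> f x) \<and>
        (\<forall>x\<in>carrier G. f (adj G x) = adj H (f x))}"


section \<open>AF-actions\<close>

text \<open>
  The maps \<open>\<phi> i\<close> are the connecting maps, and \<open>\<mu> i\<close> is the
  identification of the i-th finite-dimensional algebra with its image in A. Injective
  *-homomorphisms of C*-algebras are isometric, so A is the C*-algebraic inductive limit exactly
  when the union of the images is dense in A. The sum over U is a sum of distinct matrix
  units; a repeated summand is impossible, since \<open>\<phi> i\<close> maps matrix units to
  partial isometries.
\<close>

definition canonical_decomposition ::
    "'a::unital_cstar_algebra set \<Rightarrow> (nat \<Rightarrow> nat) \<Rightarrow> (nat \<Rightarrow> nat \<Rightarrow> nat) \<Rightarrow>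
     (nat \<Rightarrow> (nat \<Rightarrow> complex mat) \<Rightarrow> nat \<Rightarrow> complex mat) \<Rightarrow>
     (nat \<Rightarrow> (nat \<Rightarrow> complex mat) \<Rightarrow> 'a) \<Rightarrow> bool" where
  "canonical_decomposition A K n \<phi> \<mu> \<longleftrightarrow>
     (\<forall>i. K i \<ge> 1 \<and> (\<forall>j<K i. n i j \<ge> 1)) \<and>
     (\<forall>i. \<phi> i \<in> unital_star_hom (matrix_sum (K i) (n i)) (matrix_sum (K (Suc i)) (n (Suc i))) \<and>
          inj_on (\<phi> i) (carrier (matrix_sum (K i) (n i)))) \<and>
     (\<forall>i. \<forall>u\<in>matrix_units (K i) (n i). \<exists>U \<subseteq> matrix_units (K (Suc i)) (n (Suc i)).
          \<phi> i u = finsum (matrix_sum (K (Suc i)) (n (Suc i))) (\<lambda>w. w) U) \<and>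
     (\<forall>i. \<mu> i \<in> unital_star_hom (matrix_sum (K i) (n i)) ambient_algebra \<and>
          inj_on (\<mu> i) (carrier (matrix_sum (K i) (n i)))) \<and>
     (\<forall>i. \<forall>x\<in>carrier (matrix_sum (K i) (n i)). \<mu> (Suc i) (\<phi> i x) = \<mu> i x) \<and>
     A = closure (\<Union>i. \<mu> i ` carrier (matrix_sum (K i) (n i)))"

definition commutator :: "'a::ring \<Rightarrow> 'a \<Rightarrow> 'a" where
  "commutator x y = x * y - y * x"

text \<open>
  The algebra B is the whole type. A finite-dimensional A is not excluded here, but then B need not
  be singly generated: take A to be the scalars and B = D the continuous functions on a 3-cube.
\<close>

definition AF_action :: "'a::unital_cstar_algebra set \<Rightarrow> 'a set \<Rightarrow> bool" where
  "AF_action A D \<longleftrightarrow>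
     unital_cstar_subalgebra A \<and> simple_cstar A \<and> separable_space (top_of_set A) \<and> AF_algebra A \<and>
     unital_cstar_subalgebra D \<and> separable_space (top_of_set D) \<and>
     (\<exists>K n \<phi> \<mu>. canonical_decomposition A K n \<phi> \<mu> \<and>
        (let Vb = (\<lambda>i j. \<mu> i ` block_units (K i) (n i) j);
             V = (\<Union>i. \<Union>j<K i. Vb i j);
             E = (\<lambda>i j. {v \<in> Vb i j. v = star v});
             D\<^sub>0 = cstar_generated (\<Union>i. \<Union>j<K i. E i j)
         in UNIV = cstar_generated (A \<union> D) \<and>
            (\<forall>d\<in>D. \<forall>d'\<in>D\<^sub>0. commutator d d' = 0) \<and>
            (\<forall>d\<in>D. \<forall>v\<in>V. v * d * star v \<in> D)))"

end

theory Submission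
  imports Defs
begin

text \<open>
  The generator is b = h + i k with h and k self-adjoint. The commuting diagonal matrix units of all
  levels lie in the C*-algebra of one element h, so it suffices to find k such that the corners x k y,
  with x and y diagonal units, generate B.

  To generate A, choose in each block of each level one distinguished diagonal unit, such that those
  of level i + 1 lie below those of level i; let z i be their sum. The units of level i + 1
  are generated by those of level i, the diagonal, and links between the diagonal units
  below z i. The later links live below z (i + 1), which is orthogonal to one end of
  every link of level i + 1, so the links are recovered from their weighted sum level by level.

  To generate D, let d commute with the diagonal. At a level with blocks of size n it is the
  sum of the n corners f d f of a block, over all blocks, and each corner can be moved by matrix units
  to an off-diagonal position (r, s). By simplicity a fixed diagonal unit p dominates a fixed
  proportion c n of the diagonal units of every block of a fine level, so there are of the order of
  n^2 positions below p, which suffices for large n. A dense sequence of D is thus encoded in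
  orthogonal p's that are disjoint from all links.
\<close>

section \<open>C*-subalgebras\<close>

lemma star_zero [simp]: "star (0 :: 'a::unital_cstar_algebra) = 0"
  using star_add[of "0 :: 'a" 0] by simp

lemma star_scaleR: "star (r *\<^sub>R x) = r *\<^sub>R star (x :: 'a::unital_cstar_algebra)"
  by (simp add: scaleR_scaleC star_scaleC)

lemma norm_star [simp]: "norm (star x) = norm (x :: 'a::unital_cstar_algebra)"
proof -
  have le: "norm y \<le> norm (star y)" for y :: 'a
  proof (cases "y = 0")
    case False
    have "norm y * norm y \<le> norm (star y) * norm y"
      using norm_mult_ineq[of "star y" y] by (simp add: cstar_identity power2_eq_square)
    then show ?thesis using False by simp
  qed simp
  show ?thesis using le[of x] le[of "star x"] by (simp add: star_star)
qed

lemma bounded_linear_star: "bounded_linear (star :: 'a::unital_cstar_algebra \<Rightarrow> 'a)"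
  by (rule bounded_linear_intro[where K = 1]) (simp_all add: star_add star_scaleR)

lemmas star_sum = linear_sum[OF bounded_linear.linear[OF bounded_linear_star]]

lemma star_one [simp]: "star (1 :: 'a::unital_cstar_algebra) = 1"
  by (metis mult.left_neutral mult.right_neutral star_mult star_star)

lemma star_mult_self_eq_0_iff: "star x * x = 0 \<longleftrightarrow> (x :: 'a::unital_cstar_algebra) = 0"
  by (metis cstar_identity norm_eq_zero power_eq_0_iff zero_neq_numeral pos2)

lemma norm_projection:
  fixes p :: "'a::unital_cstar_algebra"
  assumes "star p = p" "p * p = p" "p \<noteq> 0"
  shows "norm p = 1"
  using cstar_identity[of p] assms by (simp add: power2_eq_square)

lemma norm_projection_le:
  fixes p :: "'a::unital_cstar_algebra"
  assumes "star p = p" "p * p = p"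
  shows "norm p \<le> 1"
  using norm_projection[of p] assms by (cases "p = 0") auto

text \<open>If \<open>x\<close> is outside \<open>S\<close>, its distance \<open>\<delta>\<close> to
  \<open>S\<close> is positive and bounds the coefficient:
  \<open>cmod c * \<delta> \<le> norm (s + c *\<^sub>C x)\<close>. Hence the coefficients along a
  convergent sequence are Cauchy. Iterated in \<open>closed_span_finite\<close>, this shows in
  \<open>ex_card_X\<close> that a finite-dimensional dense subspace of \<open>A\<close> is already
  all of \<open>A\<close>.\<close>

lemma closed_span_insert:
  fixes S :: "'a::unital_cstar_algebra set"
  assumes S: "complex_vector.subspace S" "closed S"
  shows "closed {s + c *\<^sub>C x | s c. s \<in> S}"
proof (cases "x \<in> S")
  case True
  have "{s + c *\<^sub>C x | s c. s \<in> S} = S"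
  proof safe
    fix s c assume "s \<in> S"
    then show "s + c *\<^sub>C x \<in> S"
      using S(1) True complex_vector.subspace_add complex_vector.subspace_scale by blast
  next
    fix s assume "s \<in> S"
    moreover have "s = s + 0 *\<^sub>C x" by simp
    ultimately show "\<exists>s' c. s = s' + c *\<^sub>C x \<and> s' \<in> S" by blast
  qed
  then show ?thesis using S by simp
next
  case False
  define \<delta> where "\<delta> = infdist x S"
  have ne: "S \<noteq> {}" using S(1) complex_vector.subspace_0 by blast
  have \<delta>: "\<delta> > 0"
    using infdist_pos_not_in_closed[OF S(2) ne False] unfolding \<delta>_def .
  have lower: "cmod c * \<delta> \<le> norm (s + c *\<^sub>C x)" if "s \<in> S" for s c
  proof (cases "c = 0")
    case False
    have "- ((1 / c) *\<^sub>C s) \<in> S"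
      using S(1) that complex_vector.subspace_scale complex_vector.subspace_neg by blast
    then have "\<delta> \<le> dist x (- ((1 / c) *\<^sub>C s))"
      unfolding \<delta>_def by (rule infdist_le)
    also have "\<dots> = norm ((1 / c) *\<^sub>C (s + c *\<^sub>C x))"
      using False by (simp add: dist_norm scaleC_add_right scaleC_scaleC scaleC_one add.commute)
    also have "\<dots> = norm (s + c *\<^sub>C x) / cmod c"
      by (simp add: norm_scaleC norm_divide)
    finally show ?thesis using False by (simp add: field_simps)
  qed simp
  show ?thesis
    unfolding closed_sequential_limits
  proof (intro allI impI, elim conjE)
    fix g l assume g: "\<forall>n. g n \<in> {s + c *\<^sub>C x | s c. s \<in> S}" and lim: "g \<longlonglongrightarrow> l"
    from g have "\<forall>n. \<exists>s c. g n = s + c *\<^sub>C x \<and> s \<in> S" by blast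
    then obtain s c where sc: "\<And>n. g n = s n + c n *\<^sub>C x" "\<And>n. s n \<in> S" by metis
    have diff: "cmod (c m - c n) * \<delta> \<le> norm (g m - g n)" for m n
    proof -
      have "g m - g n = (s m - s n) + (c m - c n) *\<^sub>C x"
        by (simp add: sc complex_vector.scale_left_diff_distrib)
      then show ?thesis using lower[of "s m - s n" "c m - c n"] sc(2) S(1)
        by (simp add: complex_vector.subspace_diff)
    qed
    have "Cauchy c"
    proof (rule CauchyI)
      fix e :: real assume "e > 0"
      then have "e * \<delta> > 0" using \<delta> by simp
      then obtain M where M: "\<And>m n. m \<ge> M \<Longrightarrow> n \<ge> M \<Longrightarrow> norm (g m - g n) < e * \<delta>"
        using CauchyD[OF LIMSEQ_imp_Cauchy[OF lim]] by blast
      show "\<exists>M. \<forall>m\<ge>M. \<forall>n\<ge>M. norm (c m - c n) < e"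
      proof (intro exI allI impI)
        fix m n assume "m \<ge> M" "n \<ge> M"
        then have "cmod (c m - c n) * \<delta> < e * \<delta>" using M diff le_less_trans by blast
        then show "norm (c m - c n) < e" using \<delta> by simp
      qed
    qed
    then obtain c0 where c0: "c \<longlonglongrightarrow> c0" using Cauchy_convergent_iff convergent_def by blast
    have "(\<lambda>n. c n *\<^sub>C x) \<longlonglongrightarrow> c0 *\<^sub>C x"
    proof (rule LIM_zero_cancel, rule tendsto_norm_zero_cancel)
      have "norm (c n *\<^sub>C x - c0 *\<^sub>C x) = cmod (c n - c0) * norm x" for n
        by (simp add: norm_scaleC flip: complex_vector.scale_left_diff_distrib)
      then show "(\<lambda>n. norm (c n *\<^sub>C x - c0 *\<^sub>C x)) \<longlonglongrightarrow> 0"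
        using tendsto_mult_right[OF tendsto_norm_zero[OF LIM_zero[OF c0]], of "norm x"]
        by (simp add: tendsto_mult_left_zero)
    qed
    then have "(\<lambda>n. g n - c n *\<^sub>C x) \<longlonglongrightarrow> l - c0 *\<^sub>C x" by (rule tendsto_diff[OF lim])
    then have "l - c0 *\<^sub>C x \<in> S"
      by (rule closed_sequentially[OF S(2), rotated]) (simp add: sc)
    moreover have "l = (l - c0 *\<^sub>C x) + c0 *\<^sub>C x" by simp
    ultimately show "l \<in> {s + c *\<^sub>C x | s c. s \<in> S}" by blast
  qed
qed

lemma closed_span_finite:
  fixes X :: "'a::unital_cstar_algebra set"
  assumes "finite X"
  shows "closed (complex_vector.span X)"
  using assms
proof (induction X)
  case (insert x X)
  have "complex_vector.span (insert x X) = {s + c *\<^sub>C x | s c. s \<in> complex_vector.span X}"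
  proof (intro Set.set_eqI iffI)
    fix y assume "y \<in> complex_vector.span (insert x X)"
    then obtain c where "y - c *\<^sub>C x \<in> complex_vector.span X"
      by (auto simp: complex_vector.span_insert)
    moreover have "y = (y - c *\<^sub>C x) + c *\<^sub>C x" by simp
    ultimately show "y \<in> {s + c *\<^sub>C x | s c. s \<in> complex_vector.span X}" by blast
  next
    fix y assume "y \<in> {s + c *\<^sub>C x | s c. s \<in> complex_vector.span X}"
    then obtain s c where s: "s \<in> complex_vector.span X" and y: "y = s + c *\<^sub>C x" by blast
    have "y - c *\<^sub>C x \<in> complex_vector.span X" using s by (simp add: y)
    then show "y \<in> complex_vector.span (insert x X)"
      by (auto simp: complex_vector.span_insert)
  qed
  then show ?case using closed_span_insert[OF complex_vector.subspace_span insert.IH] by simp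
qed simp

section \<open>Closure properties of C*-subalgebras\<close>

context
  fixes S :: "'a::unital_cstar_algebra set"
  assumes S: "cstar_subalgebra S"
begin

lemma cstar_subalgebra_simps:
  shows cstar_subalgebra_zero: "0 \<in> S"
    and cstar_subalgebra_add: "x \<in> S \<Longrightarrow> y \<in> S \<Longrightarrow> x + y \<in> S"
    and cstar_subalgebra_diff: "x \<in> S \<Longrightarrow> y \<in> S \<Longrightarrow> x - y \<in> S"
    and cstar_subalgebra_scaleC: "x \<in> S \<Longrightarrow> c *\<^sub>C x \<in> S"
    and cstar_subalgebra_scaleR: "x \<in> S \<Longrightarrow> t *\<^sub>R x \<in> S"
    and cstar_subalgebra_mult: "x \<in> S \<Longrightarrow> y \<in> S \<Longrightarrow> x * y \<in> S"
    and cstar_subalgebra_star: "x \<in> S \<Longrightarrow> star x \<in> S"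
    and cstar_subalgebra_sum: "(\<And>i. i \<in> I \<Longrightarrow> g i \<in> S) \<Longrightarrow> sum g I \<in> S"
  using S unfolding cstar_subalgebra_def
  by (auto simp: scaleR_scaleC complex_vector.subspace_0 complex_vector.subspace_add
      complex_vector.subspace_diff complex_vector.subspace_scale complex_vector.subspace_sum)

lemma cstar_subalgebra_limit: "(\<And>n. g n \<in> S) \<Longrightarrow> g \<longlonglongrightarrow> l \<Longrightarrow> l \<in> S"
  using S unfolding cstar_subalgebra_def closed_sequential_limits by blast

lemma cstar_subalgebra_closure: "X \<subseteq> S \<Longrightarrow> closure X \<subseteq> S"
  using S unfolding cstar_subalgebra_def by (simp add: closure_minimal)

lemma cstar_subalgebra_span: "X \<subseteq> S \<Longrightarrow> complex_vector.span X \<subseteq> S"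
  using S unfolding cstar_subalgebra_def by (simp add: complex_vector.span_minimal)

lemma cstar_subalgebra_scaleR_cancel: "t *\<^sub>R x \<in> S \<Longrightarrow> t \<noteq> 0 \<Longrightarrow> x \<in> S"
  using cstar_subalgebra_scaleR[of "t *\<^sub>R x" "1 / t"] by simp

end

lemma cstar_subalgebra_generated: "cstar_subalgebra (cstar_generated X)"
  unfolding cstar_generated_def
  by (rule hull_in) (auto simp: cstar_subalgebra_def intro: complex_vector.subspace_Inter)

lemma cstar_generated_superset: "X \<subseteq> cstar_generated X"
  unfolding cstar_generated_def by (rule hull_subset)

lemma cstar_generated_minimal: "X \<subseteq> S \<Longrightarrow> cstar_subalgebra S \<Longrightarrow> cstar_generated X \<subseteq> S"
  unfolding cstar_generated_def by (rule hull_minimal)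

text \<open>
  The polynomial 3 y^2 - 2 y^3 has attracting fixed points 0 and 1; iterating it from x converges
  to e, which replaces the functional calculus.
\<close>

lemma idempotent_near_mem_subalgebra:
  fixes x e :: "'a::unital_cstar_algebra"
  assumes S: "cstar_subalgebra S" and x: "x \<in> S"
    and e: "e * e = e" "norm e \<le> 1" and comm: "x * e = e * x" and near: "norm (x - e) \<le> 1/20"
  shows "e \<in> S"
proof -
  define g :: "'a \<Rightarrow> 'a" where "g y = 3 *\<^sub>R (y * y) - 2 *\<^sub>R (y * y * y)" for y
  have contract: "norm (g y - e) \<le> norm (y - e) / 2"
    if y: "y * e = e * y" "norm (y - e) \<le> 1/20" for y
  proof -
    define t where "t = y - e"
    have te: "t * e = e * t" using y(1) e(1) by (simp add: t_def algebra_simps)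
    have yt: "y = e + t" by (simp add: t_def)
    have 1: "e * (e * t) = e * t" "t * (e * t) = e * (t * t)" "e * (t * e) = e * t"
      by (metis te e(1) mult.assoc)+
    have n: "2 *\<^sub>R u = u + u" "3 *\<^sub>R u = u + u + u" "6 *\<^sub>R u = u + u + u + u + u + u" for u :: 'a
      using scaleR_left_distrib[of 2 1 u] scaleR_left_distrib[of 3 3 u]
      by (simp_all add: scaleR_2 add.assoc)
    \<comment> \<open>The terms linear in \<open>t\<close> cancel, so the error of
      \<open>g y\<close> is quadratic in that of \<open>y\<close>.\<close>
    have "g y - e = 3 *\<^sub>R (t * t) - 6 *\<^sub>R (e * (t * t)) - 2 *\<^sub>R (t * t * t)"
      unfolding g_def yt
      by (simp add: n algebra_simps te e(1) 1)
    also have "norm \<dots> \<le> norm (3 *\<^sub>R (t * t)) + norm (6 *\<^sub>R (e * (t * t))) + norm (2 *\<^sub>R (t * t * t))"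
      by (meson norm_triangle_ineq4 order_trans add_right_mono)
    also have "\<dots> \<le> 3 * (norm t * norm t) + 6 * (norm t * norm t) + 2 * (norm t * norm t * norm t)"
    proof -
      have tt: "norm (t * t) \<le> norm t * norm t" by (rule norm_mult_ineq)
      have ett: "norm (e * (t * t)) \<le> 1 * (norm t * norm t)"
        by (rule order_trans[OF norm_mult_ineq]) (intro mult_mono e tt; simp)
      have ttt: "norm (t * t * t) \<le> norm t * norm t * norm t"
        by (rule order_trans[OF norm_mult_ineq]) (intro mult_right_mono tt; simp)
      show ?thesis using tt ett ttt by simp
    qed
    also have "\<dots> = norm t * (9 * norm t + 2 * (norm t * norm t))" by (simp add: algebra_simps)
    also have "\<dots> \<le> norm t * (1/2)"
    proof (rule mult_left_mono)
      have t: "norm t \<le> 1/20" using y(2) t_def by simp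
      have "norm t * norm t \<le> 1/20 * (1/20)" by (intro mult_mono t) simp_all
      then show "9 * norm t + 2 * (norm t * norm t) \<le> 1/2" using t by linarith
    qed simp
    finally show ?thesis by (simp add: t_def)
  qed
  define y where "y m = (g ^^ m) x" for m
  have y: "y m \<in> S \<and> y m * e = e * y m \<and> norm (y m - e) \<le> (1/20) * (1/2) ^ m" for m
  proof (induction m)
    case 0 then show ?case using x comm near by (simp add: y_def)
  next
    case (Suc m)
    have ySuc: "y (Suc m) = g (y m)" by (simp add: y_def)
    have "(1/20) * (1/2) ^ m \<le> (1/20 :: real)" by (simp add: power_le_one)
    then have "norm (g (y m) - e) \<le> norm (y m - e) / 2" using Suc contract by force
    then have "norm (g (y m) - e) \<le> (1/20) * (1/2) ^ Suc m" using Suc by simp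
    moreover have "g (y m) \<in> S"
      using Suc by (simp add: g_def cstar_subalgebra_simps[OF S])
    moreover have "g (y m) * e = e * g (y m)"
    proof -
      have "y m * (y m * e) = e * (y m * y m)" "y m * (y m * (y m * e)) = e * (y m * (y m * y m))"
        using Suc by (metis mult.assoc)+
      then show ?thesis by (simp add: g_def algebra_simps)
    qed
    ultimately show ?case by (simp add: ySuc)
  qed
  have "(\<lambda>m. (1/20) * (1/2) ^ m :: real) \<longlonglongrightarrow> 0"
    by (intro tendsto_mult_right_zero LIMSEQ_power_zero) simp
  then have "(\<lambda>m. y m - e) \<longlonglongrightarrow> 0"
    by (rule Lim_null_comparison[rotated]) (use y in simp)
  then have "y \<longlonglongrightarrow> e" by (rule LIM_zero_cancel)
  then show "e \<in> S" using cstar_subalgebra_limit[OF S] y by blast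
qed

text \<open>Take \<open>h\<close> to be a sum of the projections with weights \<open>c ^ k\<close>.
  The tail \<open>h m = q m + c *\<^sub>R h (Suc m)\<close> is close to \<open>q m\<close>, so
  \<open>idempotent_near_mem_subalgebra\<close> extracts \<open>q m\<close> from it; subtracting and
  rescaling leaves the next tail.\<close>

lemma commuting_projections_singly_generated:
  fixes P :: "'a::unital_cstar_algebra set"
  assumes "countable P" and proj: "\<And>p. p \<in> P \<Longrightarrow> star p = p \<and> p * p = p"
    and comm: "\<And>p q. p \<in> P \<Longrightarrow> q \<in> P \<Longrightarrow> p * q = q * p"
  shows "\<exists>h. star h = h \<and> (\<forall>S. cstar_subalgebra S \<longrightarrow> h \<in> S \<longrightarrow> P \<subseteq> S)"
proof (cases "P = {}")
  case True
  then show ?thesis by (intro exI[of _ 0]) simp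
next
  case False
  define q where "q = from_nat_into P"
  have range_q: "range q = P" using range_from_nat_into[OF False assms(1)] by (simp add: q_def)
  then have qP: "q m \<in> P" for m by blast
  have nq: "norm (q m) \<le> 1" for m using proj[OF qP] norm_projection_le by blast
  \<comment> \<open>Small enough that the remainder \<open>c *\<^sub>R h (Suc m)\<close> has norm at
    most 1/40 * 40/39 = 1/39, within the radius 1/20 for extracting an idempotent.\<close>
  define c :: real where "c = 1/40"
  have gs: "summable (\<lambda>k. c ^ k)" by (rule summable_geometric) (simp add: c_def)
  have le: "norm (c ^ k *\<^sub>R q (m + k)) \<le> c ^ k" for m k
    using nq[of "m + k"] by (simp add: c_def mult_left_le)
  have sm: "summable (\<lambda>k. c ^ k *\<^sub>R q (m + k))" for m
    by (rule summable_comparison_test'[OF gs le])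
  define h where "h m = (\<Sum>k. c ^ k *\<^sub>R q (m + k))" for m
  have nh: "norm (h m) \<le> 40/39" for m
  proof -
    have "norm (h m) \<le> (\<Sum>k. c ^ k)"
      unfolding h_def by (rule norm_suminf_le[OF le gs])
    also have "\<dots> = 40/39" by (subst suminf_geometric) (simp_all add: c_def)
    finally show ?thesis .
  qed
  have h_rec: "h m = q m + c *\<^sub>R h (Suc m)" for m
  proof -
    have "h m = q m + (\<Sum>k. c ^ Suc k *\<^sub>R q (m + Suc k))"
      unfolding h_def using suminf_split_initial_segment[OF sm, of m 1] by simp
    also have "(\<Sum>k. c ^ Suc k *\<^sub>R q (m + Suc k)) = (\<Sum>k. c *\<^sub>R (c ^ k *\<^sub>R q (Suc m + k)))"
      by simp
    also have "\<dots> = c *\<^sub>R h (Suc m)"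
      unfolding h_def by (rule suminf_scaleR_right[symmetric]) (rule sm)
    finally show ?thesis .
  qed
  have hq: "h m * q j = q j * h m" for m j
  proof -
    have "h m * q j = (\<Sum>k. c ^ k *\<^sub>R q (m + k) * q j)"
      unfolding h_def by (rule suminf_mult2[OF sm])
    also have "\<dots> = (\<Sum>k. q j * (c ^ k *\<^sub>R q (m + k)))" using comm[OF qP qP] by simp
    also have "\<dots> = q j * h m" unfolding h_def by (rule suminf_mult[OF sm])
    finally show ?thesis .
  qed
  have "star (h 0) = (\<Sum>k. star (c ^ k *\<^sub>R q (0 + k)))"
    unfolding h_def by (rule bounded_linear.suminf[OF bounded_linear_star sm])
  also have "\<dots> = h 0" using proj[OF qP] by (simp add: h_def star_scaleR)
  finally have "star (h 0) = h 0" .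
  moreover have "P \<subseteq> S" if S: "cstar_subalgebra S" and h0: "h 0 \<in> S" for S
  proof -
    have step: "q m \<in> S" if "h m \<in> S" for m
    proof (rule idempotent_near_mem_subalgebra[OF S that])
      show "norm (h m - q m) \<le> 1/20" using nh[of "Suc m"] by (simp add: h_rec[of m] c_def)
    qed (use proj[OF qP] nq hq in auto)
    have "h m \<in> S" for m
    proof (induction m)
      case (Suc m)
      have "c *\<^sub>R h (Suc m) = h m - q m" by (simp add: h_rec[of m])
      also have "\<dots> \<in> S" using Suc step S by (simp add: cstar_subalgebra_diff)
      finally show ?case by (rule cstar_subalgebra_scaleR_cancel[OF S]) (simp add: c_def)
    qed (rule h0)
    then show ?thesis using step range_q by blast
  qed
  ultimately show ?thesis by blast
qed

section \<open>Systems of matrix units\<close>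

text \<open>An abstract form of the images in B of the canonical matrix units:
  \<open>e i j k l\<close> is the unit of level \<open>i\<close>, block \<open>j\<close>, row
  \<open>k\<close>, column \<open>l\<close>. Consecutive levels are related only by
  \<open>refine\<close>.\<close>

locale matrix_unit_system =
  fixes K :: "nat \<Rightarrow> nat" and n :: "nat \<Rightarrow> nat \<Rightarrow> nat"
    and e :: "nat \<Rightarrow> nat \<Rightarrow> nat \<Rightarrow> nat \<Rightarrow> 'a::unital_cstar_algebra"
  assumes n_pos: "j < K i \<Longrightarrow> 0 < n i j"
    and unit_mult: "\<lbrakk>j < K i; k < n i j; l < n i j; j' < K i; k' < n i j'; l' < n i j'\<rbrakk> \<Longrightarrow>
      e i j k l * e i j' k' l' = (if j = j' \<and> l = k' then e i j k l' else 0)"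
    and star_unit: "\<lbrakk>j < K i; k < n i j; l < n i j\<rbrakk> \<Longrightarrow> star (e i j k l) = e i j l k"
    and unit_nonzero: "\<lbrakk>j < K i; k < n i j; l < n i j\<rbrakk> \<Longrightarrow> e i j k l \<noteq> 0"
    and sum_diag: "(\<Sum>j<K i. \<Sum>k<n i j. e i j k k) = 1"
    and refine: "\<lbrakk>j < K i; k < n i j; l < n i j\<rbrakk> \<Longrightarrow>
      \<exists>I \<subseteq> {(j, k, l). j < K (Suc i) \<and> k < n (Suc i) j \<and> l < n (Suc i) j}.
        e i j k l = (\<Sum>(j', k', l')\<in>I. e (Suc i) j' k' l')"
begin

abbreviation f :: "nat \<Rightarrow> nat \<Rightarrow> nat \<Rightarrow> 'a" where
  "f i j k \<equiv> e i j k k"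

definition units :: "nat \<Rightarrow> 'a set" where
  "units i = {e i j k l | j k l. j < K i \<and> k < n i j \<and> l < n i j}"

definition diags :: "nat \<Rightarrow> 'a set" where
  "diags i = {f i j k | j k. j < K i \<and> k < n i j}"

lemma unitsI: "j < K i \<Longrightarrow> k < n i j \<Longrightarrow> l < n i j \<Longrightarrow> e i j k l \<in> units i"
  unfolding units_def by blast

lemma diagsI: "j < K i \<Longrightarrow> k < n i j \<Longrightarrow> f i j k \<in> diags i"
  unfolding diags_def by blast

lemma f_mult_f: "\<lbrakk>j < K i; k < n i j; j' < K i; k' < n i j'\<rbrakk> \<Longrightarrow>
    f i j k * f i j' k' = (if j = j' \<and> k = k' then f i j k else 0)"
  by (simp add: unit_mult)

lemma sum_diag_left: "(\<Sum>j<K i. \<Sum>k<n i j. f i j k * x) = x"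
  by (simp add: sum_diag flip: sum_distrib_right)

lemma sum_diag_right: "(\<Sum>j<K i. \<Sum>k<n i j. x * f i j k) = x"
  by (simp add: sum_diag flip: sum_distrib_left)

lemma norm_unit: "j < K i \<Longrightarrow> k < n i j \<Longrightarrow> l < n i j \<Longrightarrow> norm (e i j k l) = 1"
proof -
  assume r: "j < K i" "k < n i j" "l < n i j"
  have "norm (f i j l) = 1"
    using r by (intro norm_projection) (simp_all add: unit_mult star_unit unit_nonzero)
  then have "(norm (e i j k l))\<^sup>2 = 1"
    using cstar_identity[of "e i j k l"] r by (simp add: unit_mult star_unit)
  then show ?thesis by (simp add: power2_eq_1_iff)
      (smt (verit) norm_ge_zero)
qed

text \<open>
  Since units have norm 1, a column of a unit of level i, written in the units of level i + 1, has
  at most one nonzero entry: a column with m entries 1 has norm sqrt m.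
\<close>

lemma unit_mult_diag_Suc:
  assumes "j < K i" "k < n i j" "l < n i j" and j': "j' < K (Suc i)" and b: "b < n (Suc i) j'"
  shows "e i j k l * f (Suc i) j' b = 0 \<or>
    (\<exists>a<n (Suc i) j'. e i j k l * f (Suc i) j' b = e (Suc i) j' a b)"
proof -
  obtain I where I: "I \<subseteq> {(j, k, l). j < K (Suc i) \<and> k < n (Suc i) j \<and> l < n (Suc i) j}"
    and sumI: "e i j k l = (\<Sum>(j', k', l')\<in>I. e (Suc i) j' k' l')"
    using refine[OF assms(1-3)] by blast
  define C where "C = {a. (j', a, b) \<in> I}"
  have C: "a < n (Suc i) j'" if "a \<in> C" for a using I that by (auto simp: C_def)
  have finC: "finite C" using C by (intro finite_subset[of C "{..<n (Suc i) j'}"]) auto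
  have "I \<subseteq> (\<Union>j<K (Suc i). {j} \<times> {..<n (Suc i) j} \<times> {..<n (Suc i) j})" using I by auto
  then have finI: "finite I" by (rule finite_subset) auto
  define y where "y = e i j k l * f (Suc i) j' b"
  have "y = (\<Sum>(j'', k', l')\<in>I. if j'' = j' \<and> l' = b then e (Suc i) j' k' b else 0)"
    unfolding y_def sumI sum_distrib_right using I j' b
    by (intro sum.cong refl) (auto simp: unit_mult)
  also have "\<dots> = (\<Sum>(j'', k', l')\<in>(\<lambda>a. (j', a, b)) ` C. e (Suc i) j'' k' l')"
    by (intro sum.mono_neutral_cong_right finI) (auto simp: C_def)
  also have "\<dots> = (\<Sum>a\<in>C. e (Suc i) j' a b)"
    by (subst sum.reindex) (auto simp: inj_on_def)
  finally have y: "y = (\<Sum>a\<in>C. e (Suc i) j' a b)" .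
  have "star y * y = (\<Sum>a\<in>C. \<Sum>a'\<in>C. e (Suc i) j' b a * e (Suc i) j' a' b)"
    using C j' b by (simp add: y star_sum star_unit sum_product)
  also have "\<dots> = (\<Sum>a\<in>C. f (Suc i) j' b)"
    using C j' b finC by (intro sum.cong refl) (simp add: unit_mult sum.delta')
  also have "\<dots> = real (card C) *\<^sub>R f (Suc i) j' b" by (rule sum_constant_scaleR)
  finally have "(norm y)\<^sup>2 = card C"
    using cstar_identity[of y] norm_unit[OF j' b b] by simp
  moreover have "norm y \<le> 1 * 1"
    unfolding y_def by (rule order_trans[OF norm_mult_ineq]) (simp add: norm_unit assms)
  ultimately have "card C \<le> 1"
    by (metis mult.left_neutral norm_ge_zero of_nat_1 of_nat_le_iff power_le_one)
  then consider "C = {}" | a where "C = {a}"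
    using finC by (metis One_nat_def card_0_eq card_1_singletonE le_Suc_eq le_zero_eq)
  then show ?thesis using y C unfolding y_def[symmetric] by cases auto
qed

text \<open>Put \<open>y = f i j k * f m j' b\<close>. Then
  \<open>star y * y = f m j' b * y\<close>, which would be 0 for an off-diagonal unit
  \<open>y\<close>, although a unit is not 0.\<close>

lemma unit_mult_diag_imp_diag:
  assumes "j < K i" "k < n i j" "j' < K m" "b < n m j'" "a < n m j'"
    and eq: "f i j k * f m j' b = e m j' a b"
  shows "a = b"
proof (rule ccontr)
  assume "a \<noteq> b"
  have "f m j' b * (f i j k * f m j' b) = 0"
    using assms \<open>a \<noteq> b\<close> by (simp add: unit_mult)
  moreover have "f m j' b * (f i j k * f m j' b) = star (f i j k * f m j' b) * (f i j k * f m j' b)"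
    using assms(1-4) by (simp add: star_mult star_unit) (metis unit_mult mult.assoc)
  ultimately show False using eq unit_nonzero assms star_mult_self_eq_0_iff by metis
qed

text \<open>By induction on \<open>m\<close>. The diagonal units of level \<open>m\<close> sum to 1,
  so some \<open>f m j1 c\<close> does not annihilate the finer unit \<open>f (Suc m) j' b\<close>
  and hence dominates it. The product thus factors through \<open>e i j k l * f m j1 c\<close>,
  where the induction hypothesis applies, and the passage to level \<open>m + 1\<close> is
  \<open>unit_mult_diag_Suc\<close>.\<close>

lemma unit_mult_diag:
  assumes "i \<le> m" "j < K i" "k < n i j" "l < n i j" "j' < K m" "b < n m j'"
  shows "e i j k l * f m j' b = 0 \<or> (\<exists>a<n m j'. e i j k l * f m j' b = e m j' a b)"
  using assms(1,5,6)
proof (induction m arbitrary: j' b rule: dec_induct)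
  case base
  then show ?case using assms by (auto simp: unit_mult)
next
  case (step m)
  let ?x = "f (Suc m) j' b"
  have "\<exists>j1<K m. \<exists>c<n m j1. f m j1 c * ?x \<noteq> 0"
  proof (rule ccontr)
    assume "\<not> ?thesis"
    then have "(\<Sum>j<K m. \<Sum>k<n m j. f m j k * ?x) = 0" by (auto intro!: sum.neutral)
    then show False using sum_diag_left[where x = ?x] unit_nonzero step.prems by simp
  qed
  then obtain j1 c where j1: "j1 < K m" "c < n m j1" and nz: "f m j1 c * ?x \<noteq> 0" by blast
  then obtain a where "a < n (Suc m) j'" "f m j1 c * ?x = e (Suc m) j' a b"
    using unit_mult_diag_Suc[OF j1(1,2,2) step.prems] by blast
  then have gx: "f m j1 c * ?x = ?x"
    using unit_mult_diag_imp_diag[OF j1 step.prems] by metis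
  have eq: "e i j k l * ?x = e i j k l * f m j1 c * ?x" using gx by (simp add: mult.assoc)
  from step.IH[OF j1] show ?case
  proof (elim disjE exE conjE)
    fix a assume "a < n m j1" "e i j k l * f m j1 c = e m j1 a c"
    then show ?case
      using unit_mult_diag_Suc[OF j1(1) _ j1(2) step.prems, of a] eq by simp
  qed (simp add: eq)
qed

text \<open>The equation \<open>p * x = x\<close> is the encoding, here and below, of
  \<open>x\<close> lying below a projection \<open>p\<close>; diagonal units of two levels are
  nested or orthogonal.\<close>

lemma diag_mult_diag:
  assumes "i \<le> m" "j < K i" "k < n i j" "j' < K m" "b < n m j'"
  shows "f i j k * f m j' b = 0 \<or> f i j k * f m j' b = f m j' b"
  using unit_mult_diag[OF assms(1,2,3,3,4,5)] unit_mult_diag_imp_diag[OF assms(2-5)] by metis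

lemma star_f: "j < K i \<Longrightarrow> k < n i j \<Longrightarrow> star (f i j k) = f i j k"
  by (simp add: star_unit)

lemma f_idem: "j < K i \<Longrightarrow> k < n i j \<Longrightarrow> f i j k * f i j k = f i j k"
  by (simp add: unit_mult)

text \<open>The product of the coarser with the finer unit is 0 or the finer unit, hence
  self-adjoint; taking adjoints reverses the factors.\<close>

lemma diag_mult_diag_commute:
  assumes "j < K i" "k < n i j" "j' < K m" "b < n m j'"
  shows "f i j k * f m j' b = f m j' b * f i j k"
proof -
  have *: "f i j k * f m j' b = f m j' b * f i j k"
    if "i \<le> m" "j < K i" "k < n i j" "j' < K m" "b < n m j'" for i m j k j' b
  proof -
    have "f m j' b * f i j k = star (f i j k * f m j' b)"
      using that by (simp add: star_mult star_f)
    also have "\<dots> = f i j k * f m j' b"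
      using diag_mult_diag[OF that] star_f[OF that(4,5)] by auto
    finally show ?thesis by (rule sym)
  qed
  show ?thesis using *[of i m j k j' b] *[of m i j' b j k] assms by (cases "i \<le> m") auto
qed

lemma diag_below_ex:
  assumes "i \<le> m" "j < K m" "b < n m j"
  shows "\<exists>j'<K i. \<exists>k<n i j'. f i j' k * f m j b = f m j b"
proof (rule ccontr)
  assume "\<not> ?thesis"
  then have "f i j' k * f m j b = 0" if "j' < K i" "k < n i j'" for j' k
    using diag_mult_diag[OF assms(1) that assms(2,3)] that by blast
  then have "(\<Sum>j'<K i. \<Sum>k<n i j'. f i j' k * f m j b) = 0" by (auto intro!: sum.neutral)
  then show False using sum_diag_left[where x = "f m j b"] unit_nonzero assms by simp
qed

lemma diag_below_unique:
  assumes "f i j k * x = x" "f i j' k' * x = x" "x \<noteq> 0"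
    "j < K i" "k < n i j" "j' < K i" "k' < n i j'"
  shows "j = j' \<and> k = k'"
proof (rule ccontr)
  assume "\<not> ?thesis"
  then have "f i j k * (f i j' k' * x) = 0" using assms(4-) by (auto simp: f_mult_f simp flip: mult.assoc)
  then show False using assms by simp
qed

text \<open>The unit \<open>e i j k l\<close> is a partial isometry from \<open>f i j l\<close> onto
  \<open>f i j k\<close>, so it carries a finer diagonal unit below the first to one below the
  second. Multiplying by \<open>e i j l k\<close> undoes the move, so the product is not 0 and
  \<open>unit_mult_diag\<close> gives its form.\<close>

lemma unit_transport:
  assumes "i \<le> m" "j < K i" "k < n i j" "l < n i j" "j' < K m" "b < n m j'"
    and below: "f i j l * f m j' b = f m j' b"
  shows "\<exists>a<n m j'. e i j k l * f m j' b = e m j' a b \<and> f i j k * f m j' a = f m j' a"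
proof -
  have "e i j l k * (e i j k l * f m j' b) = f m j' b"
    using assms by (simp add: unit_mult flip: mult.assoc)
  then have "e i j k l * f m j' b \<noteq> 0" using unit_nonzero assms by fastforce
  then obtain a where a: "a < n m j'" "e i j k l * f m j' b = e m j' a b"
    using unit_mult_diag[OF assms(1-6)] by blast
  have "f i j k * e m j' a b = e m j' a b"
    unfolding a(2)[symmetric] using assms by (simp add: unit_mult flip: mult.assoc)
  then have "f i j k * (e m j' a b * e m j' b a) = e m j' a b * e m j' b a"
    by (simp add: mult.assoc[symmetric])
  then show ?thesis using a assms by (auto simp: unit_mult)
qed

lemma diag_below_trans:
  assumes "p * f i j k = f i j k" "f i j k * x = x"
  shows "p * x = x"
  using assms by (metis mult.assoc)

text \<open>The indices of the distinguished diagonal units. That the \<open>SOME\<close> has a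
  witness for the blocks of level \<open>i + 1\<close> is shown in \<open>r_ex\<close>, from the
  bound on \<open>r i\<close> that \<open>r_less\<close> establishes by induction.\<close>

primrec r :: "nat \<Rightarrow> nat \<Rightarrow> nat" where
  "r 0 = (\<lambda>_. 0)"
| "r (Suc i) = (\<lambda>j. SOME k. k < n (Suc i) j \<and>
     (\<exists>j'<K i. f i j' (r i j') * f (Suc i) j k = f (Suc i) j k))"

text \<open>Every diagonal unit of the new block, here the one with index 0, lies below some unit of
  level \<open>i\<close>, and a matrix unit of level \<open>i\<close> moves it below the
  distinguished one of the same block.\<close>

lemma r_ex:
  assumes "\<And>j. j < K i \<Longrightarrow> r i j < n i j" and j: "j < K (Suc i)"
  shows "\<exists>k. k < n (Suc i) j \<and> (\<exists>j'<K i. f i j' (r i j') * f (Suc i) j k = f (Suc i) j k)"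
proof -
  obtain j' k where j': "j' < K i" "k < n i j'" "f i j' k * f (Suc i) j 0 = f (Suc i) j 0"
    using diag_below_ex[of i "Suc i" j 0] n_pos j by auto
  show ?thesis
    using unit_transport[of i "Suc i" j' "r i j'" k j 0] j' assms n_pos by auto
qed

lemma r_less: "j < K i \<Longrightarrow> r i j < n i j"
proof (induction i arbitrary: j)
  case (Suc i)
  show ?case using someI_ex[OF r_ex[OF Suc.IH Suc.prems]] by simp
qed (simp add: n_pos)

lemma r_below: "j < K (Suc i) \<Longrightarrow>
    \<exists>j'<K i. f i j' (r i j') * f (Suc i) j (r (Suc i) j) = f (Suc i) j (r (Suc i) j)"
  using someI_ex[OF r_ex[OF r_less]] by simp

section \<open>The decreasing projections onto the distinguished units\<close>

definition z :: "nat \<Rightarrow> 'a" where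
  "z i = (\<Sum>j<K i. f i j (r i j))"

lemma star_z: "star (z i) = z i"
  by (simp add: z_def star_sum star_f r_less)

lemma z_mult_f:
  assumes "j < K i" "k < n i j"
  shows "z i * f i j k = (if k = r i j then f i j k else 0)"
proof -
  have "z i * f i j k = (\<Sum>j'<K i. if j' = j then (if k = r i j then f i j k else 0) else 0)"
    unfolding z_def sum_distrib_right using assms r_less
    by (intro sum.cong refl) (auto simp: f_mult_f)
  then show ?thesis using assms by simp
qed

lemma f_mult_z:
  assumes "j < K i" "k < n i j"
  shows "f i j k * z i = (if k = r i j then f i j k else 0)"
  using arg_cong[OF z_mult_f[OF assms], of star] assms
  by (simp add: star_mult star_z star_f split: if_splits)

lemma z_idem: "z i * z i = z i"
proof -
  have "z i * z i = (\<Sum>j<K i. z i * f i j (r i j))" by (simp add: z_def sum_distrib_left)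
  also have "\<dots> = z i" by (simp add: z_mult_f r_less) (simp add: z_def)
  finally show ?thesis .
qed

lemma z_mult_below:
  assumes "j' < K i" "f i j' (r i j') * x = x"
  shows "z i * x = x"
  by (metis assms mult.assoc z_mult_f r_less)

lemma z_mult_z_Suc: "z i * z (Suc i) = z (Suc i)"
proof -
  have "z i * f (Suc i) j (r (Suc i) j) = f (Suc i) j (r (Suc i) j)" if "j < K (Suc i)" for j
    using r_below[OF that] z_mult_below by blast
  then show ?thesis unfolding z_def[of "Suc i"] sum_distrib_left by simp
qed

text \<open>zz i dominates the links w i of level i; at level 0 all diagonal units are linked.\<close>

definition zz :: "nat \<Rightarrow> 'a" where
  "zz i = (case i of 0 \<Rightarrow> 1 | Suc i' \<Rightarrow> z i')"

lemma zz_simps [simp]: "zz 0 = 1" "zz (Suc i) = z i"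
  by (simp_all add: zz_def)

lemma star_zz: "star (zz i) = zz i"
  by (cases i) (simp_all add: star_z)

lemma zz_mult_zz: "i \<le> m \<Longrightarrow> zz i * zz m = zz m"
proof (induction m rule: dec_induct)
  case base
  show ?case by (cases i) (simp_all add: z_idem)
next
  case (step m)
  have "zz m * zz (Suc m) = zz (Suc m)" by (cases m) (simp_all add: z_mult_z_Suc)
  then show ?case using step.IH by (metis mult.assoc)
qed

lemma zz_mult_zz': "i \<le> m \<Longrightarrow> zz m * zz i = zz m"
  using arg_cong[OF zz_mult_zz, of i m star] by (simp add: star_mult star_zz)

section \<open>Links inside a block and their recovery\<close>

definition Z :: "nat \<Rightarrow> nat \<Rightarrow> nat set" where
  "Z i j = {k. k < n i j \<and> zz i * f i j k = f i j k}"

lemma Z_less: "k \<in> Z i j \<Longrightarrow> k < n i j" and zz_mult_f_Z: "k \<in> Z i j \<Longrightarrow> zz i * f i j k = f i j k"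
  by (simp_all add: Z_def)

lemma finite_Z: "finite (Z i j)"
  by (rule finite_subset[of _ "{..<n i j}"]) (auto simp: Z_less)

lemma f_mult_zz_Z: "j < K i \<Longrightarrow> k \<in> Z i j \<Longrightarrow> f i j k * zz i = f i j k"
  using arg_cong[OF zz_mult_f_Z, of k i j star] by (simp add: star_mult star_zz star_f Z_less)

text \<open>In each block this is the matrix with all entries 1 on the indices in
  \<open>Z i j\<close>. One self-adjoint element holds all links of the level, and any single link
  is read off as a corner by diagonal units.\<close>

definition w :: "nat \<Rightarrow> 'a" where
  "w i = (\<Sum>j<K i. \<Sum>k\<in>Z i j. \<Sum>l\<in>Z i j. e i j k l)"

lemma star_w: "star (w i) = w i"
proof -
  have "star (w i) = (\<Sum>j<K i. \<Sum>k\<in>Z i j. \<Sum>l\<in>Z i j. e i j l k)"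
    unfolding w_def star_sum by (intro sum.cong refl) (simp add: star_unit Z_less)
  also have "\<dots> = w i" unfolding w_def by (rule sum.cong[OF refl]) (rule sum.swap)
  finally show ?thesis .
qed

lemma zz_mult_w: "zz i * w i = w i"
  unfolding w_def sum_distrib_left
proof (intro sum.cong refl)
  fix j k l assume r: "j \<in> {..<K i}" "k \<in> Z i j" "l \<in> Z i j"
  then have "e i j k l = f i j k * e i j k l" by (simp add: unit_mult Z_less)
  then show "zz i * e i j k l = e i j k l"
    using zz_mult_f_Z[OF r(2)] by (metis mult.assoc)
qed

lemma w_mult_zz: "w i * zz i = w i"
  using arg_cong[OF zz_mult_w[of i], of star] by (simp add: star_mult star_zz star_w)

lemma f_w_f:
  assumes "j < K i" "k \<in> Z i j" "l \<in> Z i j"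
  shows "f i j k * w i * f i j l = e i j k l"
proof -
  have "f i j k * w i * f i j l =
      (\<Sum>j'<K i. \<Sum>k'\<in>Z i j'. \<Sum>l'\<in>Z i j'. f i j k * e i j' k' l' * f i j l)"
    by (simp add: w_def sum_distrib_left sum_distrib_right)
  also have "\<dots> = (\<Sum>j'<K i. if j' = j then \<Sum>k'\<in>Z i j. \<Sum>l'\<in>Z i j.
      if l' = l then (if k' = k then e i j k l else 0) else 0 else 0)"
    using assms by (intro sum.cong refl) (auto simp: unit_mult Z_less intro!: sum.cong)
  also have "\<dots> = e i j k l" using assms finite_Z by simp
  finally show ?thesis .
qed

text \<open>A later \<open>w m\<close> lives below \<open>z i\<close>, and \<open>z i\<close> keeps
  only the distinguished unit of each block of level \<open>i\<close>; two different indices cannot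
  both be distinguished.\<close>

lemma f_w_f_later:
  assumes "i < m" "j < K i" "k \<in> Z i j" "l \<in> Z i j" "k \<noteq> l"
  shows "f i j k * w m * f i j l = 0"
proof -
  have "w m = z i * w m * z i"
    using zz_mult_zz[of "Suc i" m] zz_mult_zz'[of "Suc i" m] zz_mult_w[of m] w_mult_zz[of m] assms(1)
    by (metis Suc_leI mult.assoc zz_simps(2))
  then have "f i j k * w m * f i j l = (f i j k * z i) * w m * (z i * f i j l)"
    by (metis mult.assoc)
  also have "\<dots> = 0" using assms by (auto simp: f_mult_z z_mult_f Z_less)
  finally show ?thesis .
qed

lemma w_mem: "cstar_subalgebra S \<Longrightarrow> units i \<subseteq> S \<Longrightarrow> w i \<in> S"
  unfolding w_def by (intro cstar_subalgebra_sum) (auto intro: subsetD[OF _ unitsI] Z_less)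

text \<open>Units of the previous level move each index \<open>k\<close> of a block to some index in
  \<open>Z i j\<close>, and there the links are available. An arbitrary unit is then the product of
  a move into \<open>Z i j\<close>, a link and a move back.\<close>

lemma units_Suc_mem:
  assumes S: "cstar_subalgebra S" and old: "\<And>m. m < i \<Longrightarrow> units m \<subseteq> S"
    and diag: "diags i \<subseteq> S"
    and links: "\<And>j k l. j < K i \<Longrightarrow> k \<in> Z i j \<Longrightarrow> l \<in> Z i j \<Longrightarrow> k \<noteq> l \<Longrightarrow> e i j k l \<in> S"
  shows "units i \<subseteq> S"
proof -
  have fS: "f i j k \<in> S" if "j < K i" "k < n i j" for j k using diag that by (auto simp: diags_def)
  have linkS: "e i j k l \<in> S" if "j < K i" "k \<in> Z i j" "l \<in> Z i j" for j k l
    using links[OF that] fS[OF that(1) Z_less[OF that(2)]] by (cases "k = l") auto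
  have to_Z: "\<exists>a\<in>Z i j. e i j a k \<in> S" if j: "j < K i" and k: "k < n i j" for j k
  proof (cases i)
    case 0
    \<comment> \<open>At level 0 every index already lies in \<open>Z\<close>, because
      \<open>zz 0 = 1\<close>.\<close>
    then show ?thesis using fS[OF that] k by (auto simp: Z_def)
  next
    case (Suc i')
    have "i' \<le> i" using Suc by simp
    then obtain j0 k0 where jk0: "j0 < K i'" "k0 < n i' j0" "f i' j0 k0 * f i j k = f i j k"
      using diag_below_ex[of i' i j k] j k by blast
    obtain a where a: "a < n i j" "e i' j0 (r i' j0) k0 * f i j k = e i j a k"
      "f i' j0 (r i' j0) * f i j a = f i j a"
      using unit_transport[OF \<open>i' \<le> i\<close> jk0(1) r_less[OF jk0(1)] jk0(2) j k jk0(3)] by blast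
    have "a \<in> Z i j" using a z_mult_below[OF jk0(1) a(3)] by (simp add: Z_def Suc)
    moreover have "e i' j0 (r i' j0) k0 \<in> S"
      using subsetD[OF old[of i'] unitsI[OF jk0(1) r_less[OF jk0(1)] jk0(2)]] Suc by simp
    then have "e i j a k \<in> S" unfolding a(2)[symmetric]
      using cstar_subalgebra_mult[OF S] fS[OF that] by blast
    ultimately show ?thesis by blast
  qed
  have "e i j k l \<in> S" if j: "j < K i" and k: "k < n i j" and l: "l < n i j" for j k l
  proof -
    obtain a b where a: "a \<in> Z i j" "e i j a k \<in> S" and b: "b \<in> Z i j" "e i j b l \<in> S"
      using to_Z[OF j k] to_Z[OF j l] by blast
    have "star (e i j a k) * e i j a b * e i j b l \<in> S"
      by (intro cstar_subalgebra_mult[OF S] cstar_subalgebra_star[OF S] linkS[OF j] a b)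
    then show ?thesis using a b j k l by (simp add: star_unit unit_mult Z_less)
  qed
  then show ?thesis by (auto simp: units_def)
qed

text \<open>Strong induction on the level. In the corner between two different link indices of level
  \<open>i\<close> all later \<open>w m\<close> vanish, the earlier ones are known by the induction
  hypothesis, and what remains is \<open>c i\<close> times the wanted unit. The hypothesis concerns
  corners and not the sum itself, because the generator delivers this sum only together with another
  summand whose corners vanish.\<close>

lemma units_mem:
  assumes S: "cstar_subalgebra S" and diag: "\<And>i. diags i \<subseteq> S"
    and c: "\<And>i. c i \<noteq> 0" and sm: "summable (\<lambda>i. c i *\<^sub>R w i)"
    and links: "\<And>i j k l. j < K i \<Longrightarrow> k \<in> Z i j \<Longrightarrow> l \<in> Z i j \<Longrightarrow> k \<noteq> l \<Longrightarrow>
      f i j k * (\<Sum>i. c i *\<^sub>R w i) * f i j l \<in> S"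
  shows "units i \<subseteq> S"
proof (induction i rule: less_induct)
  case (less i)
  show ?case
  proof (rule units_Suc_mem[OF S less diag])
    fix j k l assume j: "j < K i" and kl: "k \<in> Z i j" "l \<in> Z i j" "k \<noteq> l"
    let ?g = "\<lambda>m. f i j k * (c m *\<^sub>R w m) * f i j l"
    have fS: "f i j k \<in> S" "f i j l \<in> S" using diag[of i] j kl by (auto intro: diagsI Z_less)
    have "f i j k * (\<Sum>i. c i *\<^sub>R w i) * f i j l = (\<Sum>m. ?g m)"
      by (simp only: suminf_mult[OF sm, symmetric] suminf_mult2[OF summable_mult[OF sm]])
    also have "\<dots> = (\<Sum>m\<le>i. ?g m)"
      by (rule suminf_finite) (use f_w_f_later j kl in auto)
    also have "\<dots> = (\<Sum>m<i. ?g m) + c i *\<^sub>R e i j k l"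
      by (simp add: lessThan_Suc_atMost[symmetric] f_w_f j kl)
    finally have "c i *\<^sub>R e i j k l = f i j k * (\<Sum>i. c i *\<^sub>R w i) * f i j l - (\<Sum>m<i. ?g m)"
      by simp
    also have "\<dots> \<in> S"
    proof (rule cstar_subalgebra_diff[OF S links[OF j kl]], rule cstar_subalgebra_sum[OF S])
      fix m assume "m \<in> {..<i}"
      then show "?g m \<in> S" using less w_mem[OF S] fS
        by (intro cstar_subalgebra_mult[OF S] cstar_subalgebra_scaleR[OF S]) auto
    qed
    finally show "e i j k l \<in> S" using cstar_subalgebra_scaleR_cancel[OF S] c by blast
  qed
qed

end

section \<open>Simple infinite-dimensional AF algebras\<close>

lemma closed_tendsto_zero:
  fixes T :: "nat \<Rightarrow> 'a::real_normed_vector \<Rightarrow> 'b::real_normed_vector"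
  assumes diff: "\<And>i x y. T i (x - y) = T i x - T i y" and bound: "\<And>i x. norm (T i x) \<le> C * norm x"
    and C: "C > 0"
  shows "closed {x. (\<lambda>i. T i x) \<longlonglongrightarrow> 0}"
  unfolding closed_sequential_limits
proof (intro allI impI, elim conjE)
  fix x l assume x: "\<forall>m. x m \<in> {x. (\<lambda>i. T i x) \<longlonglongrightarrow> 0}" and lim: "x \<longlonglongrightarrow> l"
  have "(\<lambda>i. T i l) \<longlonglongrightarrow> 0"
  proof (rule LIMSEQ_I)
    fix \<epsilon> :: real assume \<epsilon>: "\<epsilon> > 0"
    then obtain m where m: "norm (x m - l) < \<epsilon> / (2 * C)"
      using LIMSEQ_D[OF lim, of "\<epsilon> / (2 * C)"] C by auto
    obtain i0 where i0: "\<And>i. i \<ge> i0 \<Longrightarrow> norm (T i (x m) - 0) < \<epsilon> / 2"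
      using LIMSEQ_D[of "\<lambda>i. T i (x m)" 0 "\<epsilon> / 2"] x \<epsilon> by auto
    have "norm (T i l - 0) < \<epsilon>" if "i \<ge> i0" for i
    proof -
      have "norm (T i l) \<le> norm (T i (x m)) + norm (T i (x m - l))"
        using norm_triangle_ineq4[of "T i (x m)" "T i (x m - l)"] by (simp add: diff)
      also have "norm (T i (x m - l)) < \<epsilon> / 2"
        using m C by (intro le_less_trans[OF bound]) (simp add: field_simps)
      finally show ?thesis using i0[OF that] by simp
    qed
    then show "\<exists>i0. \<forall>i\<ge>i0. norm (T i l - 0) < \<epsilon>" by blast
  qed
  then show "l \<in> {x. (\<lambda>i. T i x) \<longlonglongrightarrow> 0}" by simp
qed

text \<open>Take rows and columns from disjoint subsets \<open>R\<close> and \<open>S\<close> of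
  \<open>C\<close>, each with \<open>a = card C div 2\<close> elements. The bound
  \<open>6 * q + 2\<close> gives \<open>3 * q \<le> a\<close>, so
  \<open>N \<le> q * (2 * a + 1) \<le> a * a\<close>. In \<open>encode_in_corner\<close> the
  disjointness keeps a sum of entries in these positions apart from its adjoint.\<close>

lemma disjoint_pairs_enumeration:
  assumes "finite C" and le: "N \<le> q * card C" and large: "6 * q + 2 \<le> card C"
  shows "\<exists>\<rho> \<sigma>. (\<forall>k<N. \<rho> k \<in> C \<and> \<sigma> k \<in> C) \<and> inj_on (\<lambda>k. (\<rho> k, \<sigma> k)) {..<N} \<and>
    (\<forall>k<N. \<forall>l<N. \<rho> k \<noteq> \<sigma> l)"
proof -
  define a where "a = card C div 2"
  have a: "3 * q \<le> a" "1 \<le> a" "card C \<le> 2 * a + 1" "2 * a \<le> card C" using large by (auto simp: a_def)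
  have "N \<le> q * (2 * a + 1)" by (rule order_trans[OF le mult_le_mono2[OF a(3)]])
  then have "3 * N \<le> 3 * q * (2 * a + 1)" by simp
  also have "\<dots> \<le> a * (3 * a)" using a by (intro mult_mono) auto
  finally have Na: "N \<le> a * a" by simp
  obtain R where R: "R \<subseteq> C" "card R = a" "finite R"
    using a obtain_subset_with_card_n[of a C] by auto
  have "a \<le> card (C - R)" using R a by (simp add: card_Diff_subset)
  then obtain S where S: "S \<subseteq> C - R" "card S = a" "finite S"
    using obtain_subset_with_card_n[of a "C - R"] by auto
  have "card {..<N} \<le> card (R \<times> S)" using Na R S by (simp add: card_cartesian_product)
  then obtain g where g: "g ` {..<N} \<subseteq> R \<times> S" "inj_on g {..<N}"
    using card_le_inj[of "{..<N}" "R \<times> S"] R S by auto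
  have g_mem: "fst (g k) \<in> R" "snd (g k) \<in> S" if "k < N" for k
    using g(1) that by (auto simp: mem_Times_iff)
  show ?thesis
  proof (rule exI[of _ "fst \<circ> g"], rule exI[of _ "snd \<circ> g"], intro conjI allI impI)
    show "inj_on (\<lambda>k. ((fst \<circ> g) k, (snd \<circ> g) k)) {..<N}" using g(2) by simp
    show "(fst \<circ> g) k \<noteq> (snd \<circ> g) l" if "k < N" "l < N" for k l
      using g_mem that S(1) by fastforce
  qed (use g_mem R(1) S(1) in auto)
qed

lemma ex_summable_scaling:
  fixes x :: "nat \<Rightarrow> 'a::banach"
  shows "\<exists>c. (\<forall>i. c i \<noteq> 0) \<and> summable (\<lambda>i. c i *\<^sub>R x i)"
proof (intro exI conjI allI)
  let ?c = "\<lambda>i. (1/2) ^ i / (norm (x i) + 1) :: real"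
  have pos: "norm (x i) + 1 > 0" for i by (simp add: add_nonneg_pos)
  show "?c i \<noteq> 0" for i using pos[of i] by simp
  have le: "norm (?c i *\<^sub>R x i) \<le> (1/2) ^ i" for i
    using pos[of i] by (simp add: divide_simps mult_left_le)
  show "summable (\<lambda>i. ?c i *\<^sub>R x i)"
    by (rule summable_comparison_test'[OF summable_geometric le]) simp
qed

locale simple_AF_system = matrix_unit_system +
  fixes A
  assumes A_eq: "A = closure (\<Union>i. complex_vector.span (units i))"
    and A_subalgebra: "unital_cstar_subalgebra A"
    and A_simple: "simple_cstar A"
    and A_infinite: "\<not> finite_dimensional A"
begin

lemma K_pos: "0 < K i"
proof (rule ccontr)
  assume "\<not> 0 < K i"
  then show False using sum_diag[of i] by simp
qed

lemma span_units_mono: "i \<le> m \<Longrightarrow> complex_vector.span (units i) \<subseteq> complex_vector.span (units m)"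
proof (induction m rule: dec_induct)
  case (step m)
  have "units m \<subseteq> complex_vector.span (units (Suc m))"
  proof
    fix x assume "x \<in> units m"
    then obtain j k l where jkl: "j < K m" "k < n m j" "l < n m j" and x_eq: "x = e m j k l"
      unfolding units_def by blast
    then obtain I where "I \<subseteq> {(j, k, l). j < K (Suc m) \<and> k < n (Suc m) j \<and> l < n (Suc m) j}"
      and x: "x = (\<Sum>(j', k', l')\<in>I. e (Suc m) j' k' l')"
      unfolding x_eq using refine[OF jkl] by blast
    then show "x \<in> complex_vector.span (units (Suc m))" unfolding x
      by (intro complex_vector.span_sum) (auto intro!: complex_vector.span_base unitsI)
  qed
  then show ?case
    using step.IH complex_vector.span_minimal[OF _ complex_vector.subspace_span] by blast
qed simp

lemma units_subset_A: "units i \<subseteq> A"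
proof -
  have "units i \<subseteq> (\<Union>i. complex_vector.span (units i))"
    using complex_vector.span_superset[of "units i"] by blast
  then show ?thesis unfolding A_eq using closure_subset by (rule subset_trans)
qed

text \<open>
  If every later level had a block with no diagonal unit below p, then the units u of these
  blocks would be asymptotically central, and the x with x u tending to 0 would form a proper
  nonzero ideal of A.
\<close>

lemma diag_full_ex:
  assumes p: "j0 < K i0" "k0 < n i0 j0"
  shows "\<exists>i\<ge>i0. \<forall>j<K i. \<exists>k<n i j. f i0 j0 k0 * f i j k = f i j k"
proof (rule ccontr)
  define p where "p = f i0 j0 k0"
  assume "\<not> ?thesis"
  then have "\<exists>j<K (i0 + i). \<forall>k<n (i0 + i) j. p * f (i0 + i) j k \<noteq> f (i0 + i) j k" for i
    unfolding p_def by (meson le_add1)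
  then obtain J where J: "\<And>i. J i < K (i0 + i)"
    "\<And>i k. k < n (i0 + i) (J i) \<Longrightarrow> p * f (i0 + i) (J i) k \<noteq> f (i0 + i) (J i) k" by metis
  have pJ: "p * f (i0 + i) (J i) k = 0" if "k < n (i0 + i) (J i)" for i k
    using diag_mult_diag[of i0 "i0 + i" j0 k0 "J i" k] J that assms unfolding p_def by auto
  \<comment> \<open>The unit of the block \<open>J i\<close> of level \<open>i0 + i\<close>, hence
    central in the span of that level and, by the choice of \<open>J\<close>, orthogonal to
    \<open>p\<close>.\<close>
  define u where "u i = (\<Sum>k<n (i0 + i) (J i). f (i0 + i) (J i) k)" for i
  have u_unit: "u i * e (i0 + i) j k l = (if j = J i then e (i0 + i) j k l else 0)"
    if "j < K (i0 + i)" "k < n (i0 + i) j" "l < n (i0 + i) j" for i j k l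
    unfolding u_def sum_distrib_right using that J(1)[of i]
    by (auto simp: unit_mult if_distrib cong: if_cong)
  have unit_u: "e (i0 + i) j k l * u i = (if j = J i then e (i0 + i) j k l else 0)"
    if "j < K (i0 + i)" "k < n (i0 + i) j" "l < n (i0 + i) j" for i j k l
    unfolding u_def sum_distrib_left using that J(1)[of i]
    by (auto simp: unit_mult if_distrib cong: if_cong)
  have pu: "p * u i = 0" for i unfolding u_def sum_distrib_left using pJ by simp
  have nu: "norm (u i) = 1" for i
  proof (rule norm_projection)
    show "star (u i) = u i" unfolding u_def star_sum using J(1) by (simp add: star_f)
    show "u i * u i = u i"
      unfolding u_def[of i] sum_distrib_left
      by (intro sum.cong refl, fold u_def) (use u_unit J(1) in auto)
    show "u i \<noteq> 0"
      using u_unit[of "J i" i 0 0] J(1)[of i] n_pos[OF J(1)[of i]] unit_nonzero[OF J(1)[of i]] by auto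
  qed
  have central: "a * u i = u i * a" if "a \<in> complex_vector.span (units (i0 + i))" for a i
  proof -
    have "units (i0 + i) \<subseteq> {a. a * u i = u i * a}"
      by (auto simp: units_def u_unit unit_u)
    moreover have "complex_vector.subspace {a. a * u i = u i * a}"
      by (auto simp: complex_vector.subspace_def distrib_left distrib_right mult_scaleC_left mult_scaleC_right)
    ultimately show ?thesis using complex_vector.span_minimal that by blast
  qed
  have asymp: "(\<lambda>i. a * u i - u i * a) \<longlonglongrightarrow> 0" if "a \<in> A" for a
  proof -
    have "closed {a. (\<lambda>i. a * u i - u i * a) \<longlonglongrightarrow> 0}"
    proof (rule closed_tendsto_zero[where C = 2])
      fix i x
      have "norm (x * u i - u i * x) \<le> norm (x * u i) + norm (u i * x)" by (rule norm_triangle_ineq4)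
      also have "\<dots> \<le> norm x * norm (u i) + norm (u i) * norm x"
        by (intro add_mono norm_mult_ineq)
      finally show "norm (x * u i - u i * x) \<le> 2 * norm x" by (simp add: nu)
    qed (simp_all add: algebra_simps)
    moreover have "(\<Union>i. complex_vector.span (units i)) \<subseteq> {a. (\<lambda>i. a * u i - u i * a) \<longlonglongrightarrow> 0}"
    proof safe
      fix a m assume a: "a \<in> complex_vector.span (units m)"
      have "a * u i - u i * a = 0" if "i \<ge> m" for i
        using central[of a i] span_units_mono[of m "i0 + i"] a that by auto
      then have "eventually (\<lambda>i. a * u i - u i * a = 0) sequentially"
        by (auto simp: eventually_sequentially)
      then show "(\<lambda>i. a * u i - u i * a) \<longlonglongrightarrow> 0" by (rule tendsto_eventually)
    qed
    ultimately show ?thesis using that closure_minimal unfolding A_eq by blast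
  qed
  have A: "cstar_subalgebra A" "1 \<in> A" using A_subalgebra by (auto simp: unital_cstar_subalgebra_def)
  define I where "I = A \<inter> {x. (\<lambda>i. x * u i) \<longlonglongrightarrow> 0}"
  have "closed_ideal A I"
    unfolding closed_ideal_def
  proof (intro conjI ballI)
    show "I \<subseteq> A" by (simp add: I_def)
    show "complex_vector.subspace I"
    proof (rule complex_vector.subspaceI)
      fix c x assume x: "x \<in> I"
      have "(\<lambda>i. (c *\<^sub>C 1) * (x * u i)) \<longlonglongrightarrow> 0"
        using x by (intro tendsto_mult_right_zero[where f = "\<lambda>i. x * u i"]) (simp add: I_def)
      then show "c *\<^sub>C x \<in> I"
        using x cstar_subalgebra_scaleC[OF A(1)] by (simp add: I_def mult_scaleC_left)
    qed (auto simp: I_def distrib_right cstar_subalgebra_simps[OF A(1)] intro: tendsto_add_zero)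
    have "closed {x. (\<lambda>i. x * u i) \<longlonglongrightarrow> 0}"
    proof (rule closed_tendsto_zero[where C = 1])
      show "norm (x * u i) \<le> 1 * norm x" for i x using norm_mult_ineq[of x "u i"] by (simp add: nu)
    qed (simp_all add: left_diff_distrib)
    then show "closed I" using A(1) by (simp add: I_def cstar_subalgebra_def closed_Int)
    fix a x assume a: "a \<in> A" and x: "x \<in> I"
    have "(\<lambda>i. a * (x * u i)) \<longlonglongrightarrow> 0"
      using x by (intro tendsto_mult_right_zero[where f = "\<lambda>i. x * u i"]) (simp add: I_def)
    then show "a * x \<in> I"
      using x a cstar_subalgebra_mult[OF A(1)] by (simp add: I_def mult.assoc)
    \<comment> \<open>Asymptotic centrality enters here: \<open>x * a * u i\<close> is split into a
      commutator term and \<open>x * u i * a\<close>.\<close>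
    have "(\<lambda>i. x * (a * u i - u i * a) + x * u i * a) \<longlonglongrightarrow> 0"
      using x asymp[OF a]
      by (intro tendsto_add_zero tendsto_mult_right_zero[where f = "\<lambda>i. a * u i - u i * a"]
          tendsto_mult_left_zero[where f = "\<lambda>i. x * u i"]) (simp_all add: I_def)
    moreover have "x * (a * u i - u i * a) + x * u i * a = x * a * u i" for i
      by (simp add: algebra_simps)
    ultimately show "x * a \<in> I"
      using x a cstar_subalgebra_mult[OF A(1)] by (simp add: I_def)
  qed
  moreover have "p \<in> I" using units_subset_A unitsI[OF assms assms(2)] by (auto simp: I_def p_def pu[unfolded p_def])
  moreover have "p \<noteq> 0" using assms unit_nonzero by (simp add: p_def)
  moreover have "1 \<notin> I"
  proof
    assume "1 \<in> I"
    then have "(\<lambda>i. norm (u i)) \<longlonglongrightarrow> 0" using tendsto_norm_zero by (auto simp: I_def)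
    then show False by (simp add: nu LIMSEQ_const_iff)
  qed
  ultimately show False using A_simple A(2) unfolding simple_cstar_def by blast
qed

text \<open>The property persists to all later levels: a unit of a later block lies below some unit
  of level \<open>i1\<close>, and a matrix unit of level \<open>i1\<close> moves it below a unit of
  the same block that lies below \<open>f i0 j0 k0\<close>.\<close>

lemma diag_full:
  assumes "j0 < K i0" "k0 < n i0 j0"
  shows "\<exists>i1\<ge>i0. \<forall>i\<ge>i1. \<forall>j<K i. \<exists>k<n i j. f i0 j0 k0 * f i j k = f i j k"
proof -
  obtain i1 where "i1 \<ge> i0" and i1: "\<And>j. j < K i1 \<Longrightarrow> \<exists>k<n i1 j. f i0 j0 k0 * f i1 j k = f i1 j k"
    using diag_full_ex[OF assms] by blast
  have "\<exists>k<n i j. f i0 j0 k0 * f i j k = f i j k" if i: "i1 \<le> i" and j: "j < K i" for i j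
  proof -
    obtain j' k where jk: "j' < K i1" "k < n i1 j'" "f i1 j' k * f i j 0 = f i j 0"
      using diag_below_ex[OF i j n_pos[OF j]] by blast
    obtain k' where k': "k' < n i1 j'" "f i0 j0 k0 * f i1 j' k' = f i1 j' k'" using i1 jk by blast
    obtain a where "a < n i j" "f i1 j' k' * f i j a = f i j a"
      using unit_transport[OF i jk(1) k'(1) jk(2) j n_pos[OF j] jk(3)] by blast
    then show ?thesis using diag_below_trans[OF k'(2)] by blast
  qed
  then show ?thesis using \<open>i1 \<ge> i0\<close> by blast
qed

section \<open>Growth of the blocks\<close>

definition X :: "nat \<Rightarrow> (nat \<times> nat) set" where
  "X i = (SIGMA j:{..<K i}. {..<n i j})"

lemma finite_X: "finite (X i)"
  by (simp add: X_def)

lemma card_units_le: "finite (units i) \<and> card (units i) \<le> card (X i) * card (X i)"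
proof -
  let ?g = "\<lambda>((j, k), (j', l)). e i j k l"
  have sub: "units i \<subseteq> ?g ` (X i \<times> X i)"
  proof
    fix x assume "x \<in> units i"
    then obtain j k l where "j < K i" "k < n i j" "l < n i j" "x = e i j k l"
      unfolding units_def by blast
    then show "x \<in> ?g ` (X i \<times> X i)"
      by (intro image_eqI[of _ _ "((j, k), (j, l))"]) (auto simp: X_def)
  qed
  have fin: "finite (X i \<times> X i)" using finite_X by simp
  have "card (units i) \<le> card (X i \<times> X i)"
    by (rule order_trans[OF card_mono[OF finite_imageI[OF fin] sub] card_image_le[OF fin]])
  then show ?thesis using finite_subset[OF sub] fin by (simp add: card_cartesian_product)
qed

text \<open>If all levels had fewer than \<open>L\<close> diagonal units, all spans would have
  dimension at most \<open>L * L\<close>. As the spans increase, their union would have a finite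
  basis, hence be closed and equal to \<open>A\<close>, against \<open>A_infinite\<close>.\<close>

lemma ex_card_X: "\<exists>i. L \<le> card (X i)"
proof (rule ccontr)
  assume "\<not> ?thesis"
  then have small: "card (X i) \<le> L" for i by (meson nat_le_linear)
  define H where "H = (\<Union>i. complex_vector.span (units i))"
  obtain B where B: "B \<subseteq> H" "complex_vector.independent B" "H \<subseteq> complex_vector.span B"
    using complex_vector.maximal_independent_subset by blast
  have "finite B"
  proof (rule ccontr)
    assume "infinite B"
    then obtain F where F: "finite F" "card F = Suc (L * L)" "F \<subseteq> B"
      using infinite_arbitrarily_large by blast
    have "\<forall>x\<in>F. \<exists>i. x \<in> complex_vector.span (units i)" using F(3) B(1) unfolding H_def by blast
    then obtain g where g: "\<And>x. x \<in> F \<Longrightarrow> x \<in> complex_vector.span (units (g x))" by metis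
    obtain m where m: "\<And>x. x \<in> F \<Longrightarrow> g x \<le> m"
      using finite_nat_set_iff_bounded_le[of "g ` F"] F(1) by auto
    have Fm: "F \<subseteq> complex_vector.span (units m)" using g span_units_mono[OF m] by blast
    have "complex_vector.independent F" using B(2) F(3) complex_vector.independent_mono by blast
    then have "card F \<le> card (units m)"
      using complex_vector.independent_span_bound[of "units m" F] card_units_le Fm by blast
    also have "\<dots> \<le> card (X m) * card (X m)" using card_units_le by blast
    also have "\<dots> \<le> L * L" using small by (intro mult_mono) auto
    finally show False using F(2) by simp
  qed
  moreover have "A \<subseteq> complex_vector.span B"
    unfolding A_eq H_def[symmetric] using B(3) closed_span_finite[OF \<open>finite B\<close>]
    by (rule closure_minimal)
  ultimately show False using A_infinite by (auto simp: finite_dimensional_def)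
qed

text \<open>Start from a level with at least \<open>L\<close> diagonal units in total. By
  simplicity, in the form of \<open>diag_full\<close>, every block of a sufficiently late level
  contains a unit below each of them, and these are different because the units of one level are
  orthogonal.\<close>

lemma n_large: "\<exists>i1. \<forall>m\<ge>i1. \<forall>j<K m. L \<le> n m j"
proof -
  obtain i where i: "L \<le> card (X i)" using ex_card_X by blast
  have "\<forall>t\<in>X i. \<exists>i1. \<forall>m\<ge>i1. \<forall>j<K m. \<exists>k<n m j. f i (fst t) (snd t) * f m j k = f m j k"
    using diag_full by (fastforce simp: X_def)
  then obtain g where g: "\<And>t m j. t \<in> X i \<Longrightarrow> m \<ge> g t \<Longrightarrow> j < K m \<Longrightarrow>
      \<exists>k<n m j. f i (fst t) (snd t) * f m j k = f m j k" by metis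
  obtain M where M: "\<And>t. t \<in> X i \<Longrightarrow> g t \<le> M"
    using finite_nat_set_iff_bounded_le[of "g ` X i"] finite_X by auto
  have "L \<le> n m j" if m: "m \<ge> M" and j: "j < K m" for m j
  proof -
    have "\<forall>t\<in>X i. \<exists>k<n m j. f i (fst t) (snd t) * f m j k = f m j k"
      using g M m j order_trans by blast
    then obtain h where h: "\<And>t. t \<in> X i \<Longrightarrow> h t < n m j"
      "\<And>t. t \<in> X i \<Longrightarrow> f i (fst t) (snd t) * f m j (h t) = f m j (h t)" by metis
    have "inj_on h (X i)"
    proof (rule inj_onI)
      fix s t assume st: "s \<in> X i" "t \<in> X i" "h s = h t"
      have "fst s = fst t \<and> snd s = snd t"
      proof (rule diag_below_unique)
        show "f i (fst s) (snd s) * f m j (h s) = f m j (h s)" using h st by blast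
        show "f i (fst t) (snd t) * f m j (h s) = f m j (h s)" using h st by metis
      qed (use st h unit_nonzero j in \<open>auto simp: X_def\<close>)
      then show "s = t" by (simp add: prod_eq_iff)
    qed
    then have "card (X i) \<le> card {..<n m j}" using h by (intro card_inj_on_le) auto
    then show ?thesis using i by simp
  qed
  then show ?thesis by blast
qed

section \<open>The share of a block below a fixed diagonal unit\<close>

definition below :: "'a \<Rightarrow> nat \<Rightarrow> nat \<Rightarrow> nat set" where
  "below p m j = {k. k < n m j \<and> p * f m j k = f m j k}"

lemma finite_below: "finite (below p m j)"
  by (rule finite_subset[of _ "{..<n m j}"]) (auto simp: below_def)

text \<open>Fix a level \<open>i\<close> each of whose blocks \<open>j'\<close> has a unit with
  index \<open>g j'\<close> below \<open>p\<close>. In a later block an index \<open>k\<close> lies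
  below some unit \<open>k'\<close> of a block \<open>j'\<close> of level \<open>i\<close>, and the
  matrix unit from \<open>k'\<close> to \<open>g j'\<close> moves it to an index \<open>a\<close>
  below \<open>p\<close>. Since \<open>k\<close> is determined by \<open>j'\<close>,
  \<open>k'\<close> and \<open>a\<close>, the constant \<open>q = card (X i)\<close> works.\<close>

lemma n_le_card_below:
  assumes "j0 < K i0" "k0 < n i0 j0"
  shows "\<exists>q i1. \<forall>m\<ge>i1. \<forall>j<K m. n m j \<le> q * card (below (f i0 j0 k0) m j)"
proof -
  define p where "p = f i0 j0 k0"
  obtain i where i: "\<And>j. j < K i \<Longrightarrow> \<exists>k<n i j. p * f i j k = f i j k"
    using diag_full_ex[OF assms] unfolding p_def by blast
  then obtain g where g: "\<And>j. j < K i \<Longrightarrow> g j < n i j" "\<And>j. j < K i \<Longrightarrow> p * f i j (g j) = f i j (g j)"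
    by metis
  have "n m j \<le> card (X i) * card (below p m j)" if m: "m \<ge> i" and j: "j < K m" for m j
  proof -
    have "\<exists>j' k' a. j' < K i \<and> k' < n i j' \<and> a \<in> below p m j \<and> e i j' (g j') k' * f m j k = e m j a k"
      if k: "k < n m j" for k
    proof -
      obtain j' k' where jk: "j' < K i" "k' < n i j'" "f i j' k' * f m j k = f m j k"
        using diag_below_ex[OF m j k] by blast
      obtain a where a: "a < n m j" "e i j' (g j') k' * f m j k = e m j a k"
        "f i j' (g j') * f m j a = f m j a"
        using unit_transport[OF m jk(1) g(1)[OF jk(1)] jk(2) j k jk(3)] by blast
      have "a \<in> below p m j" using diag_below_trans[OF g(2)[OF jk(1)] a(3)] a(1) by (simp add: below_def)
      then show ?thesis using jk a by blast
    qed
    then obtain h h' a where h: "\<And>k. k < n m j \<Longrightarrow> h k < K i \<and> h' k < n i (h k) \<and> a k \<in> below p m j \<and>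
        e i (h k) (g (h k)) (h' k) * f m j k = e m j (a k) k" by metis
    \<comment> \<open>If \<open>k\<close> and \<open>l\<close> had the same data, the same partial
      isometry \<open>?v\<close> would move both to \<open>a k\<close>; undoing it with
      \<open>star ?v\<close> yields \<open>f m j l = e m j k l\<close>, which is impossible for
      \<open>k \<noteq> l\<close>.\<close>
    have "inj_on (\<lambda>k. ((h k, h' k), a k)) {..<n m j}"
    proof (rule inj_onI, rule ccontr)
      fix k l assume k: "k \<in> {..<n m j}" and l: "l \<in> {..<n m j}" and "k \<noteq> l"
        and eq: "((h k, h' k), a k) = ((h l, h' l), a l)"
      let ?v = "e i (h k) (g (h k)) (h' k)"
      have ak: "a k < n m j" using h k by (auto simp: below_def)
      have "?v * f m j l = e m j (a k) l" using h[of l] l eq by auto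
      also have "\<dots> = e m j (a k) k * e m j k l" using j k l ak by (simp add: unit_mult)
      also have "\<dots> = ?v * (f m j k * e m j k l)" using h[of k] k by (simp flip: mult.assoc)
      finally have "star ?v * ?v * f m j l = star ?v * ?v * f m j k * e m j k l"
        using j k l by (simp add: mult.assoc)
      moreover have "star ?v * ?v = f i (h k) (h' k)" using h[of k] k g by (simp add: star_unit unit_mult)
      ultimately have eq: "f i (h k) (h' k) * f m j l = f i (h k) (h' k) * f m j k * e m j k l" by simp
      have *: "f i (h k) (h' k) * f m j l' = f m j l'" if "l' < n m j" "?v * f m j l' = e m j (a k) l'" for l'
      proof -
        have "?v * f m j l' \<noteq> 0" using that unit_nonzero j ak by simp
        then have "f i (h k) (h' k) * f m j l' \<noteq> 0"
          using h[of k] k g unit_mult[of "h k" i "g (h k)" "h' k" "h k" "h' k" "h' k"]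
          by (metis lessThan_iff mult.assoc mult_zero_right)
        then show ?thesis using diag_mult_diag[OF m, of "h k" "h' k" j l'] h[of k] k that j by auto
      qed
      have "f m j l = e m j k l"
        using eq *[of l] *[of k] h[of k] h[of l] k l \<open>((h k, h' k), a k) = ((h l, h' l), a l)\<close> j
        by (simp add: unit_mult)
      then have "f m j l * f m j l = f m j l * e m j k l" by simp
      then show False using j k l \<open>k \<noteq> l\<close> unit_nonzero[of j m l l] by (simp add: unit_mult)
    qed
    moreover have "(\<lambda>k. ((h k, h' k), a k)) ` {..<n m j} \<subseteq> X i \<times> below p m j"
      using h by (auto simp: X_def)
    ultimately have "card {..<n m j} \<le> card (X i \<times> below p m j)"
      using finite_X finite_below by (intro card_inj_on_le) auto
    then show ?thesis by (simp add: card_cartesian_product)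
  qed
  then show ?thesis unfolding p_def by blast
qed

lemma below_large:
  assumes "j0 < K i0" "k0 < n i0 j0"
  shows "\<exists>i1. \<forall>m\<ge>i1. \<forall>j<K m. L \<le> card (below (f i0 j0 k0) m j)"
proof -
  obtain q i1 where i1: "\<And>m j. m \<ge> i1 \<Longrightarrow> j < K m \<Longrightarrow> n m j \<le> q * card (below (f i0 j0 k0) m j)"
    using n_le_card_below[OF assms] by blast
  obtain i2 where i2: "\<And>m j. m \<ge> i2 \<Longrightarrow> j < K m \<Longrightarrow> Suc (q * L) \<le> n m j"
    using n_large by blast
  have "L \<le> card (below (f i0 j0 k0) m j)" if "m \<ge> max i1 i2" "j < K m" for m j
  proof (rule ccontr)
    assume "\<not> ?thesis"
    then have "q * card (below (f i0 j0 k0) m j) \<le> q * L" by (intro mult_le_mono2) simp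
    moreover have "n m j \<le> q * card (below (f i0 j0 k0) m j)" "Suc (q * L) \<le> n m j"
      using i1 i2 that by auto
    ultimately show False by linarith
  qed
  then show ?thesis by blast
qed

text \<open>A block of a late level has at least two units below \<open>f N 0 (r N 0)\<close>, and
  only one unit of the block is distinguished. Another one leaves room for an encoding below
  \<open>z N\<close> but orthogonal to \<open>z i\<close>.\<close>

lemma free_diag_ex: "\<exists>i>N. \<exists>j<K i. \<exists>k<n i j. z N * f i j k = f i j k \<and> k \<noteq> r i j"
proof -
  obtain i1 where i1: "\<And>m j. m \<ge> i1 \<Longrightarrow> j < K m \<Longrightarrow> 2 \<le> card (below (f N 0 (r N 0)) m j)"
    using below_large[OF K_pos r_less[OF K_pos]] by blast
  define i where "i = max i1 (Suc N)"
  have c: "2 \<le> card (below (f N 0 (r N 0)) i 0)" using i1 K_pos by (simp add: i_def)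
  have "\<not> below (f N 0 (r N 0)) i 0 \<subseteq> {r i 0}"
    using c card_mono[of "{r i 0}" "below (f N 0 (r N 0)) i 0"] by auto
  then obtain k where "k \<in> below (f N 0 (r N 0)) i 0" "k \<noteq> r i 0" by auto
  then have "k < n i 0 \<and> z N * f i 0 k = f i 0 k \<and> k \<noteq> r i 0"
    using z_mult_below[OF K_pos] by (simp add: below_def)
  moreover have "i > N" by (simp add: i_def)
  ultimately show ?thesis using K_pos by blast
qed

text \<open>
  An element commuting with the diagonal has only n j entries per block of a fine level, so they
  fit into the off-diagonal corner of pairs of diagonal units below p.
\<close>

lemma encode_in_corner:
  assumes p: "j0 < K i0" "k0 < n i0 j0"
    and d: "\<And>i j k. j < K i \<Longrightarrow> k < n i j \<Longrightarrow> d * f i j k = f i j k * d"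
  shows "\<exists>y. star y = y \<and> f i0 j0 k0 * y * f i0 j0 k0 = y \<and>
    (\<forall>S. cstar_subalgebra S \<longrightarrow> (\<forall>i. units i \<subseteq> S) \<longrightarrow> y \<in> S \<longrightarrow> d \<in> S)"
proof -
  define p where "p = f i0 j0 k0"
  obtain q i1 where i1: "\<And>m j. m \<ge> i1 \<Longrightarrow> j < K m \<Longrightarrow> n m j \<le> q * card (below p m j)"
    using n_le_card_below[OF assms(1,2)] unfolding p_def by blast
  obtain i2 where i2: "\<And>m j. m \<ge> i2 \<Longrightarrow> j < K m \<Longrightarrow> 6 * q + 2 \<le> card (below p m j)"
    using below_large[OF assms(1,2)] unfolding p_def by blast
  define m where "m = max i1 i2"
  have "\<forall>j\<in>{..<K m}. \<exists>\<rho> \<sigma>. (\<forall>k<n m j. \<rho> k \<in> below p m j \<and> \<sigma> k \<in> below p m j) \<and>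
      inj_on (\<lambda>k. (\<rho> k, \<sigma> k)) {..<n m j} \<and> (\<forall>k<n m j. \<forall>l<n m j. \<rho> k \<noteq> \<sigma> l)"
  proof
    fix j assume "j \<in> {..<K m}"
    then show "\<exists>\<rho> \<sigma>. (\<forall>k<n m j. \<rho> k \<in> below p m j \<and> \<sigma> k \<in> below p m j) \<and>
      inj_on (\<lambda>k. (\<rho> k, \<sigma> k)) {..<n m j} \<and> (\<forall>k<n m j. \<forall>l<n m j. \<rho> k \<noteq> \<sigma> l)"
      using i1[of m j] i2[of m j] finite_below
      by (intro disjoint_pairs_enumeration[where q = q]) (auto simp: m_def)
  qed
  from bchoice[OF this] obtain \<rho> where "\<forall>j\<in>{..<K m}. \<exists>\<sigma>.
      (\<forall>k<n m j. \<rho> j k \<in> below p m j \<and> \<sigma> k \<in> below p m j) \<and>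
      inj_on (\<lambda>k. (\<rho> j k, \<sigma> k)) {..<n m j} \<and> (\<forall>k<n m j. \<forall>l<n m j. \<rho> j k \<noteq> \<sigma> l)" by blast
  from bchoice[OF this] obtain \<sigma> where \<rho>\<sigma>: "\<And>j k. j < K m \<Longrightarrow> k < n m j \<Longrightarrow> \<rho> j k \<in> below p m j \<and> \<sigma> j k \<in> below p m j"
    and inj: "\<And>j. j < K m \<Longrightarrow> inj_on (\<lambda>k. (\<rho> j k, \<sigma> j k)) {..<n m j}"
    and disj: "\<And>j k l. j < K m \<Longrightarrow> k < n m j \<Longrightarrow> l < n m j \<Longrightarrow> \<rho> j k \<noteq> \<sigma> j l"
    by (simp add: Ball_def) blast
  have less: "\<rho> j k < n m j" "\<sigma> j k < n m j" if "j < K m" "k < n m j" for j k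
    using \<rho>\<sigma>[OF that] by (auto simp: below_def)
  \<comment> \<open>The corner \<open>f m j k * d * f m j k\<close>, moved to row
    \<open>\<rho> j k\<close> and column \<open>\<sigma> j k\<close>.\<close>
  define x where "x j k = e m j (\<rho> j k) k * d * e m j k (\<sigma> j k)" for j k
  define T where "T = (\<Sum>j<K m. \<Sum>k<n m j. x j k)"
  have px: "p * x j k = x j k" "x j k * p = x j k" if "j < K m" "k < n m j" for j k
  proof -
    have "p * f m j (\<rho> j k) = f m j (\<rho> j k)" "p * f m j (\<sigma> j k) = f m j (\<sigma> j k)"
      using \<rho>\<sigma>[OF that] by (auto simp: below_def)
    moreover have "f m j (\<sigma> j k) * p = p * f m j (\<sigma> j k)"
      unfolding p_def using diag_mult_diag_commute that less p by metis
    moreover have "x j k = f m j (\<rho> j k) * x j k" "x j k = x j k * f m j (\<sigma> j k)"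
      unfolding x_def using that less by (simp_all add: unit_mult mult.assoc flip: mult.assoc[of "f m j (\<rho> j k)"])
    ultimately show "p * x j k = x j k" "x j k * p = x j k" by (metis mult.assoc)+
  qed
  have pT: "p * T = T" "T * p = T"
    by (simp_all add: T_def sum_distrib_left sum_distrib_right px)
  have "star p = p" using p star_f by (simp add: p_def)
  then have pT': "p * star T = star T" "star T * p = star T" using pT star_mult by metis+
  \<comment> \<open>Injectivity of the pairs removes the other summands of \<open>T\<close>. The
    rows of \<open>star T\<close> are indexed by \<open>\<sigma>\<close>, so disjointness of the two
    index ranges removes all of \<open>star T\<close>.\<close>
  have entry: "f m j (\<rho> j k) * (T + star T) * f m j (\<sigma> j k) = x j k" if j: "j < K m" and k: "k < n m j" for j k
  proof -
    have "f m j (\<rho> j k) * x j' k' * f m j (\<sigma> j k) = (if j' = j \<and> k' = k then x j k else 0)"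
      if "j' < K m" "k' < n m j'" for j' k'
    proof -
      have "f m j (\<rho> j k) * x j' k' * f m j (\<sigma> j k) =
          (f m j (\<rho> j k) * e m j' (\<rho> j' k') k') * d * (e m j' k' (\<sigma> j' k') * f m j (\<sigma> j k))"
        by (simp add: x_def mult.assoc)
      also have "\<dots> = (if j' = j \<and> \<rho> j k' = \<rho> j k \<and> \<sigma> j k' = \<sigma> j k then x j' k' else 0)"
        using that j k less by (auto simp: unit_mult x_def)
      also have "j' = j \<and> \<rho> j k' = \<rho> j k \<and> \<sigma> j k' = \<sigma> j k \<longleftrightarrow> j' = j \<and> k' = k"
        using inj[OF j] that k by (auto simp: inj_on_def)
      finally show ?thesis by simp
    qed
    then have "f m j (\<rho> j k) * T * f m j (\<sigma> j k) = (\<Sum>j'<K m. \<Sum>k'<n m j'. if j' = j \<and> k' = k then x j k else 0)"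
      by (simp add: T_def sum_distrib_left sum_distrib_right)
    also have "\<dots> = (\<Sum>j'<K m. if j' = j then x j k else 0)"
      using k by (intro sum.cong refl) auto
    also have "\<dots> = x j k" using j by simp
    finally have T: "f m j (\<rho> j k) * T * f m j (\<sigma> j k) = x j k" .
    have "f m j (\<rho> j k) * star (x j' k') = 0" if "j' < K m" "k' < n m j'" for j' k'
    proof -
      have "f m j (\<rho> j k) * star (x j' k') = (f m j (\<rho> j k) * e m j' (\<sigma> j' k') k') * (star d * e m j' k' (\<rho> j' k'))"
        using that less by (simp add: x_def star_mult star_unit mult.assoc)
      also have "f m j (\<rho> j k) * e m j' (\<sigma> j' k') k' = 0"
        using that j k less disj[of j k k'] by (auto simp: unit_mult)
      finally show ?thesis by simp
    qed
    then have "f m j (\<rho> j k) * star T = 0"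
      by (simp add: T_def star_sum sum_distrib_left)
    then show ?thesis using T by (simp add: distrib_left distrib_right)
  qed
  have "d \<in> S" if S: "cstar_subalgebra S" and u: "\<And>i. units i \<subseteq> S" and T: "T + star T \<in> S" for S
  proof -
    \<comment> \<open>Moving the entry back gives \<open>f m j k * d * f m j k\<close>, which equals
      \<open>d * f m j k\<close> by commutation; these sum to \<open>d\<close>.\<close>
    have "d * f m j k \<in> S" if j: "j < K m" and k: "k < n m j" for j k
    proof -
      have eS: "e m j a b \<in> S" if "a < n m j" "b < n m j" for a b using u unitsI j that by blast
      have "x j k \<in> S" unfolding entry[OF j k, symmetric]
        using T eS less[OF j k] by (intro cstar_subalgebra_mult[OF S]) auto
      then have "e m j k (\<rho> j k) * x j k * e m j (\<sigma> j k) k \<in> S"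
        using eS less[OF j k] k by (intro cstar_subalgebra_mult[OF S]) auto
      moreover have "e m j k (\<rho> j k) * x j k * e m j (\<sigma> j k) k =
          (e m j k (\<rho> j k) * e m j (\<rho> j k) k) * d * (e m j k (\<sigma> j k) * e m j (\<sigma> j k) k)"
        by (simp add: x_def mult.assoc)
      moreover have "\<dots> = d * f m j k"
        using less[OF j k] j k d[OF j k, symmetric] by (simp add: unit_mult) (simp add: mult.assoc unit_mult)
      ultimately show ?thesis by simp
    qed
    then have "(\<Sum>j<K m. \<Sum>k<n m j. d * f m j k) \<in> S"
      by (intro cstar_subalgebra_sum[OF S]) auto
    then show ?thesis by (simp add: sum_diag_right)
  qed
  moreover have "star (T + star T) = T + star T" by (simp add: star_add star_star add.commute)
  moreover have "p * (T + star T) * p = T + star T" by (simp add: distrib_left distrib_right pT pT')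
  ultimately show ?thesis unfolding p_def by blast
qed

text \<open>Repeated use of \<open>free_diag_ex\<close>, each time below the \<open>z\<close> of the
  level chosen before. Not being distinguished, the unit chosen at level \<open>I m\<close> is
  annihilated by \<open>z (I m)\<close>, while all later ones lie below \<open>z (I m)\<close> since
  the projections \<open>z\<close> decrease.\<close>

lemma free_diag_sequence:
  "\<exists>(I :: nat \<Rightarrow> nat) J k. \<forall>m. J m < K (I m) \<and> k m < n (I m) (J m) \<and> z (I m) * f (I m) (J m) (k m) = 0 \<and>
    (\<forall>m'>m. z (I m) * f (I m') (J m') (k m') = f (I m') (J m') (k m'))"
proof -
  let ?ok = "\<lambda>(i, j, k). j < K i \<and> k < n i j \<and> k \<noteq> r i j"
  let ?next = "\<lambda>(i, j, k) (i', j', k'). i < i' \<and> z i * f i' j' k' = f i' j' k'"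
  have ex: "\<exists>y. ?ok y \<and> ?next x y" for x
  proof -
    obtain i j k where "i > fst x" "j < K i" "k < n i j" "z (fst x) * f i j k = f i j k" "k \<noteq> r i j"
      using free_diag_ex by blast
    then show ?thesis by (intro exI[of _ "(i, j, k)"]) (auto split: prod.split)
  qed
  have "\<exists>s. \<forall>m. ?ok (s m) \<and> ?next (s m) (s (Suc m))"
  proof (rule dependent_nat_choice)
    \<comment> \<open>\<open>ex\<close> holds for every triple, valid or not, so an arbitrary
      predecessor gives a start.\<close>
    show "\<exists>x. ?ok x" using ex[of undefined] by (rule ex_forward) (erule conjunct1)
    show "\<exists>y. ?ok y \<and> ?next x y" for x by (rule ex)
  qed
  then obtain s where s: "\<forall>m. ?ok (s m) \<and> ?next (s m) (s (Suc m))" by (rule exE)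
  define I J k where "I m = fst (s m)" and "J m = fst (snd (s m))" and "k m = snd (snd (s m))" for m
  have s_eq: "s m = (I m, J m, k m)" for m by (simp add: I_def J_def k_def)
  have ok: "J m < K (I m)" "k m < n (I m) (J m)" "k m \<noteq> r (I m) (J m)" for m
    using spec[OF s, of m] by (simp_all add: s_eq)
  have step: "I m < I (Suc m)" "z (I m) * f (I (Suc m)) (J (Suc m)) (k (Suc m)) = f (I (Suc m)) (J (Suc m)) (k (Suc m))" for m
    using spec[OF s, of m] by (simp_all add: s_eq)
  have "z (I m) * f (I m') (J m') (k m') = f (I m') (J m') (k m')" if lt: "m < m'" for m m'
  proof -
    obtain m0 where m0: "m' = Suc m0" "m \<le> m0" using lt by (cases m') auto
    have "I m \<le> I m0" using less_imp_le[OF step(1)] m0(2) by (rule lift_Suc_mono_le)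
    then have "z (I m) * z (I m0) = z (I m0)" using zz_mult_zz[of "Suc (I m)" "Suc (I m0)"] by simp
    moreover have "z (I m) * f (I m') (J m') (k m') = z (I m) * z (I m0) * f (I m') (J m') (k m')"
      using step(2)[of m0] by (simp add: m0(1) mult.assoc)
    ultimately show ?thesis using step(2)[of m0] by (simp add: m0(1))
  qed
  then show ?thesis using ok z_mult_f by (intro exI[of _ I] exI[of _ J] exI[of _ k]) auto
qed

text \<open>The two sums inside \<open>b\<close> are told apart by corners. Those between different
  link indices vanish on \<open>kD\<close>, so all units are recovered first; then \<open>kA\<close>
  is known and can be subtracted, and the corner of \<open>kD\<close> at \<open>p m\<close> is a
  multiple of \<open>y m\<close>, which encodes \<open>d m\<close>.\<close>

lemma generated_with_commuting_sequence:
  fixes d :: "nat \<Rightarrow> 'a"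
  assumes d: "\<And>m i j k. j < K i \<Longrightarrow> k < n i j \<Longrightarrow> d m * f i j k = f i j k * d m"
  shows "\<exists>b. \<forall>S. cstar_subalgebra S \<longrightarrow> b \<in> S \<longrightarrow> A \<subseteq> S \<and> range d \<subseteq> S"
proof -
  from free_diag_sequence obtain I J \<kappa> :: "nat \<Rightarrow> nat" where seq: "\<forall>m. J m < K (I m) \<and>
      \<kappa> m < n (I m) (J m) \<and> z (I m) * f (I m) (J m) (\<kappa> m) = 0 \<and>
      (\<forall>m'>m. z (I m) * f (I m') (J m') (\<kappa> m') = f (I m') (J m') (\<kappa> m'))"
    by (elim exE)
  have I: "\<And>m. J m < K (I m)" "\<And>m. \<kappa> m < n (I m) (J m)"
    "\<And>m. z (I m) * f (I m) (J m) (\<kappa> m) = 0"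
    "\<And>m m'. m < m' \<Longrightarrow> z (I m) * f (I m') (J m') (\<kappa> m') = f (I m') (J m') (\<kappa> m')"
    using seq by simp_all
  define p where "p m = f (I m) (J m) (\<kappa> m)" for m
  have zp: "z (I m) * p m = 0" for m using I by (simp add: p_def)
  have zp': "m < m' \<Longrightarrow> z (I m) * p m' = p m'" for m m' using I by (simp add: p_def)
  have star_p: "star (p m) = p m" for m using I star_f by (simp add: p_def)
  have pz: "p m * z (I m) = 0" for m
    using arg_cong[OF zp[of m], of star] by (simp add: star_mult star_p star_z)
  \<comment> \<open>The projection \<open>z (I m)\<close> separates the two: it annihilates
    \<open>p m\<close> and fixes every later \<open>p m'\<close>.\<close>
  have p_orth_less: "p m * p m' = 0" if "m < m'" for m m'
  proof -
    have "p m * p m' = p m * z (I m) * p m'" using zp'[OF that] by (simp add: mult.assoc)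
    then show ?thesis by (simp add: pz)
  qed
  have p_orth: "p m * p m' = 0" if "m \<noteq> m'" for m m'
    using p_orth_less[of m m'] arg_cong[OF p_orth_less[of m' m], of star] that
    by (cases m m' rule: linorder_cases) (simp_all add: star_mult star_p)
  \<comment> \<open>If \<open>i \<le> I m\<close>, then \<open>p m\<close> lies below at most one of
    two orthogonal units of level \<open>i\<close>. Otherwise both units lie below
    \<open>zz i\<close> and so below \<open>z (I m)\<close>, which annihilates
    \<open>p m\<close>.\<close>
  have p_link: "f i j k * p m = 0 \<or> p m * f i j l = 0"
    if j: "j < K i" and kl: "k \<in> Z i j" "l \<in> Z i j" "k \<noteq> l" for i j k l m
  proof (cases "i \<le> I m")
    case True
    have "f i j k * p m = 0 \<or> f i j l * p m = 0"
    proof (rule ccontr)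
      assume "\<not> ?thesis"
      then have "f i j k * p m = p m" "f i j l * p m = p m" "p m \<noteq> 0"
        using diag_mult_diag[OF True j _ I(1,2)] Z_less kl unfolding p_def by fastforce+
      then show False using diag_below_unique j kl Z_less by blast
    qed
    then show ?thesis
    proof
      assume "f i j l * p m = 0"
      then have "star (f i j l * p m) = 0" by simp
      then show ?thesis using star_f[OF j Z_less[OF kl(2)]] by (simp add: star_mult star_p)
    qed simp
  next
    case False
    have "zz i * z (I m) = zz i" using zz_mult_zz'[of "Suc (I m)" i] False by simp
    then have "f i j k * p m = f i j k * (zz i * z (I m)) * p m"
      using f_mult_zz_Z[OF j kl(1)] by simp
    also have "\<dots> = f i j k * zz i * (z (I m) * p m)" by (simp only: mult.assoc)
    finally show ?thesis by (simp add: zp)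
  qed
  have "\<forall>m. \<exists>y. star y = y \<and> p m * y * p m = y \<and>
      (\<forall>S. cstar_subalgebra S \<longrightarrow> (\<forall>i. units i \<subseteq> S) \<longrightarrow> y \<in> S \<longrightarrow> d m \<in> S)"
    unfolding p_def by (intro allI encode_in_corner[OF I(1,2)] d)
  then obtain y where y: "\<And>m. star (y m) = y m" "\<And>m. p m * y m * p m = y m"
    and y_d: "\<And>m S. cstar_subalgebra S \<Longrightarrow> (\<And>i. units i \<subseteq> S) \<Longrightarrow> y m \<in> S \<Longrightarrow> d m \<in> S"
    by metis
  obtain c where c: "\<And>i. c i \<noteq> 0" and sc: "summable (\<lambda>i. c i *\<^sub>R w i)"
    using ex_summable_scaling[of w] by blast
  obtain c' where c': "\<And>m. c' m \<noteq> 0" and sc': "summable (\<lambda>m. c' m *\<^sub>R y m)"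
    using ex_summable_scaling[of y] by blast
  define kA where "kA = (\<Sum>i. c i *\<^sub>R w i)"
  define kD where "kD = (\<Sum>m. c' m *\<^sub>R y m)"
  have star_k: "star kA = kA" "star kD = kD"
    unfolding kA_def kD_def bounded_linear.suminf[OF bounded_linear_star sc]
      bounded_linear.suminf[OF bounded_linear_star sc']
    by (simp_all add: star_scaleR star_w y)
  have sandwich: "u * kD * v = (\<Sum>m. c' m *\<^sub>R (u * y m * v))" for u v
  proof -
    have "u * kD * v = (\<Sum>m. u * (c' m *\<^sub>R y m) * v)"
      unfolding kD_def suminf_mult[OF sc', symmetric] by (rule suminf_mult2[OF summable_mult[OF sc']])
    then show ?thesis by simp
  qed
  have link_kD: "f i j k * kD * f i j l = 0"
    if "j < K i" "k \<in> Z i j" "l \<in> Z i j" "k \<noteq> l" for i j k l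
  proof -
    have split: "f i j k * (p m * y m * p m) * f i j l = (f i j k * p m) * y m * (p m * f i j l)" for m
      by (simp only: mult.assoc)
    have "f i j k * y m * f i j l = 0" for m 
      using p_link[OF that, of m] split[of m, unfolded y(2)] by auto
    then show ?thesis by (simp add: sandwich)
  qed
  have corner_kD: "p m * kD * p m = c' m *\<^sub>R y m" for m
  proof -
    have split: "p m * (p m' * y m' * p m') * p m = (p m * p m') * y m' * (p m' * p m)" for m'
      by (simp only: mult.assoc)
    have "p m * y m' * p m = 0" if "m' \<noteq> m" for m'
      using p_orth[of m m'] split[of m', unfolded y(2)] that by simp
    then have "p m * kD * p m = (\<Sum>m'\<in>{m}. c' m' *\<^sub>R (p m * y m' * p m))"
      unfolding sandwich by (intro suminf_finite) auto
    then show ?thesis by (simp add: y)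
  qed
  have "countable (\<Union>i. diags i)"
  proof (intro countable_UN countableI_type)
    fix i
    have "diags i \<subseteq> range (\<lambda>(j, k). f i j k)" by (auto simp: diags_def)
    then show "countable (diags i)" by (rule countable_subset) simp
  qed
  moreover have "star q = q \<and> q * q = q" if "q \<in> (\<Union>i. diags i)" for q
    using that by (auto simp: diags_def star_f f_idem)
  moreover have "q * q' = q' * q" if "q \<in> (\<Union>i. diags i)" "q' \<in> (\<Union>i. diags i)" for q q'
    using that by (auto simp: diags_def intro: diag_mult_diag_commute)
  ultimately obtain h where h: "star h = h"
    and h_diags: "\<And>S. cstar_subalgebra S \<Longrightarrow> h \<in> S \<Longrightarrow> (\<Union>i. diags i) \<subseteq> S"
    using commuting_projections_singly_generated[of "\<Union>i. diags i"] by blast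
  define b where "b = h + \<i> *\<^sub>C (kA + kD)"
  have "A \<subseteq> S \<and> range d \<subseteq> S" if S: "cstar_subalgebra S" and b: "b \<in> S" for S
  proof -
    have "star b = h + (- \<i>) *\<^sub>C (kA + kD)"
      by (simp add: b_def star_add star_scaleC h star_k)
    then have "h = (1/2) *\<^sub>R (b + star b)"
      by (simp add: b_def scaleR_add_right[symmetric] scaleR_2[symmetric])
    then have hS: "h \<in> S" using b S by (simp add: cstar_subalgebra_simps)
    have "kA + kD = (- \<i>) *\<^sub>C (b - h)" by (simp add: b_def scaleC_scaleC)
    also have "\<dots> \<in> S" by (intro cstar_subalgebra_scaleC[OF S] cstar_subalgebra_diff[OF S] b hS)
    finally have kS: "kA + kD \<in> S" .
    have diagS: "diags i \<subseteq> S" for i using h_diags[OF S hS] by blast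
    have unitS: "units i \<subseteq> S" for i
    proof (rule units_mem[OF S diagS c sc])
      fix i j k l assume jkl: "j < K i" "k \<in> Z i j" "l \<in> Z i j" "k \<noteq> l"
      have "f i j k * (kA + kD) * f i j l \<in> S"
        using kS diagS diagsI jkl Z_less by (intro cstar_subalgebra_mult[OF S]) blast+
      then show "f i j k * (\<Sum>i. c i *\<^sub>R w i) * f i j l \<in> S"
        using link_kD[OF jkl] by (simp add: kA_def distrib_left distrib_right)
    qed
    have "A \<subseteq> S" unfolding A_eq using unitS
      by (intro cstar_subalgebra_closure[OF S] UN_least cstar_subalgebra_span[OF S])
    moreover have "d m \<in> S" for m
    proof (rule y_d[OF S unitS])
      have "kA \<in> S"
        unfolding kA_def
        by (rule cstar_subalgebra_limit[OF S _ summable_LIMSEQ[OF sc]])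
          (intro cstar_subalgebra_sum[OF S] cstar_subalgebra_scaleR[OF S] w_mem[OF S unitS])
      then have "kD \<in> S" using cstar_subalgebra_diff[OF S kS] by fastforce
      moreover have "p m \<in> S" using diagS diagsI[OF I(1,2)] unfolding p_def by blast
      ultimately have "c' m *\<^sub>R y m \<in> S"
        unfolding corner_kD[symmetric] by (intro cstar_subalgebra_mult[OF S])
      then show "y m \<in> S" using cstar_subalgebra_scaleR_cancel[OF S] c' by blast
    qed
    ultimately show ?thesis by blast
  qed
  then show ?thesis by blast
qed

end

section \<open>Canonical decompositions\<close>

definition unit_index :: "nat \<Rightarrow> (nat \<Rightarrow> nat) \<Rightarrow> (nat \<times> nat \<times> nat) set" where
  "unit_index K n = (SIGMA j:{..<K}. {..<n j} \<times> {..<n j})"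

lemma finite_unit_index: "finite (unit_index K n)"
  by (simp add: unit_index_def)

lemma sum_unit_index:
  "(\<Sum>(j, k, l)\<in>unit_index K n. F j k l) = (\<Sum>j<K. \<Sum>k<n j. \<Sum>l<n j. F j k l)"
  by (simp add: unit_index_def sum.cartesian_product sum.Sigma)

lemma matrix_unit_entry:
  assumes "j' < K" "r < n j'" "c < n j'"
  shows "matrix_unit K n j k l j' $$ (r, c) = (if j' = j \<and> r = k \<and> c = l then 1 else 0)"
  using assms by (simp add: matrix_unit_def)

lemma matrix_unit_carrier: "matrix_unit K n j k l \<in> carrier (matrix_sum K n)"
  by (auto simp: matrix_unit_def matrix_sum_def)

lemma matrix_sum_carrier_mat:
  "x \<in> carrier (matrix_sum K n) \<Longrightarrow> j < K \<Longrightarrow> x j \<in> carrier_mat (n j) (n j)"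
  by (auto simp: matrix_sum_def)

lemma matrix_sum_eqI:
  assumes x: "x \<in> carrier (matrix_sum K n)" and y: "y \<in> carrier (matrix_sum K n)"
    and eq: "\<And>j r c. j < K \<Longrightarrow> r < n j \<Longrightarrow> c < n j \<Longrightarrow> x j $$ (r, c) = y j $$ (r, c)"
  shows "x = y"
proof (rule PiE_ext)
  show "x \<in> (\<Pi>\<^sub>E j\<in>{..<K}. carrier_mat (n j) (n j))" "y \<in> (\<Pi>\<^sub>E j\<in>{..<K}. carrier_mat (n j) (n j))"
    using x y by (simp_all add: matrix_sum_def)
  fix j assume j: "j \<in> {..<K}"
  then have "x j \<in> carrier_mat (n j) (n j)" "y j \<in> carrier_mat (n j) (n j)"
    using matrix_sum_carrier_mat x y by auto
  then show "x j = y j" using eq[of j] j by (intro eq_matI) auto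
qed

text \<open>The monoid laws are what evaluating the \<open>finsum\<close> in
  \<open>canonical_decomposition\<close> requires.\<close>

lemma abelian_monoid_matrix_sum: "abelian_monoid (matrix_sum K n)"
proof (rule abelian_monoidI)
  fix x y w assume x: "x \<in> carrier (matrix_sum K n)" and y: "y \<in> carrier (matrix_sum K n)"
    and w: "w \<in> carrier (matrix_sum K n)"
  show "x \<oplus>\<^bsub>matrix_sum K n\<^esub> y \<oplus>\<^bsub>matrix_sum K n\<^esub> w =
      x \<oplus>\<^bsub>matrix_sum K n\<^esub> (y \<oplus>\<^bsub>matrix_sum K n\<^esub> w)"
    using matrix_sum_carrier_mat[OF x] matrix_sum_carrier_mat[OF y] matrix_sum_carrier_mat[OF w]
    by (auto simp: matrix_sum_def intro!: restrict_ext assoc_add_mat)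
next
  fix x y assume x: "x \<in> carrier (matrix_sum K n)" and y: "y \<in> carrier (matrix_sum K n)"
  show "x \<oplus>\<^bsub>matrix_sum K n\<^esub> y \<in> carrier (matrix_sum K n)"
    using matrix_sum_carrier_mat[OF x] matrix_sum_carrier_mat[OF y]
    by (auto simp: matrix_sum_def)
  show "x \<oplus>\<^bsub>matrix_sum K n\<^esub> y = y \<oplus>\<^bsub>matrix_sum K n\<^esub> x"
    using comm_add_mat[OF matrix_sum_carrier_mat[OF x] matrix_sum_carrier_mat[OF y]]
    by (auto simp: matrix_sum_def intro!: restrict_ext)
next
  fix x assume x: "x \<in> carrier (matrix_sum K n)"
  show "\<zero>\<^bsub>matrix_sum K n\<^esub> \<oplus>\<^bsub>matrix_sum K n\<^esub> x = x"
    using x by (auto simp: matrix_sum_def fun_eq_iff PiE_def Pi_def extensional_def)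
qed (auto simp: matrix_sum_def)

interpretation matrix_sum: abelian_monoid "matrix_sum K n" for K n
  by (rule abelian_monoid_matrix_sum)

lemma matrix_sum_add_entry:
  assumes "x \<in> carrier (matrix_sum K n)" "y \<in> carrier (matrix_sum K n)" "j < K" "r < n j" "c < n j"
  shows "(x \<oplus>\<^bsub>matrix_sum K n\<^esub> y) j $$ (r, c) = x j $$ (r, c) + y j $$ (r, c)"
  using matrix_sum_carrier_mat[OF assms(1,3)] matrix_sum_carrier_mat[OF assms(2,3)] assms(3-)
  by (auto simp: matrix_sum_def)

lemma matrix_sum_finsum_entry:
  assumes "finite U" "g \<in> U \<rightarrow> carrier (matrix_sum K n)" "j < K" "r < n j" "c < n j"
  shows "finsum (matrix_sum K n) g U j $$ (r, c) = (\<Sum>u\<in>U. g u j $$ (r, c))"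
  using assms
proof (induction U)
  case empty
  then show ?case unfolding matrix_sum.finsum_empty by (simp add: matrix_sum_def)
next
  case (insert u U)
  then have "g \<in> U \<rightarrow> carrier (matrix_sum K n)" "g u \<in> carrier (matrix_sum K n)" by auto
  then show ?case using insert by (simp add: matrix_sum_add_entry)
qed

section \<open>The image of a direct sum of matrix algebras under a unital star-homomorphism\<close>

context
  fixes K :: nat and n :: "nat \<Rightarrow> nat" and \<mu> :: "(nat \<Rightarrow> complex mat) \<Rightarrow> 'a::unital_cstar_algebra"
  assumes \<mu>: "\<mu> \<in> unital_star_hom (matrix_sum K n) ambient_algebra"
begin

lemma hom_simps:
  assumes "x \<in> carrier (matrix_sum K n)"
  shows hom_add: "y \<in> carrier (matrix_sum K n) \<Longrightarrow> \<mu> (x \<oplus>\<^bsub>matrix_sum K n\<^esub> y) = \<mu> x + \<mu> y"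
    and hom_mult: "y \<in> carrier (matrix_sum K n) \<Longrightarrow> \<mu> (x \<otimes>\<^bsub>matrix_sum K n\<^esub> y) = \<mu> x * \<mu> y"
    and hom_smult: "\<mu> (c \<odot>\<^bsub>matrix_sum K n\<^esub> x) = c *\<^sub>C \<mu> x"
    and hom_adj: "\<mu> (adj (matrix_sum K n) x) = star (\<mu> x)"
  using \<mu> assms by (auto simp: unital_star_hom_def Ring.ring_hom_def ambient_algebra_def)

lemma hom_one: "\<mu> \<one>\<^bsub>matrix_sum K n\<^esub> = 1"
  using \<mu> by (auto simp: unital_star_hom_def Ring.ring_hom_def ambient_algebra_def)

lemma hom_zero: "\<mu> \<zero>\<^bsub>matrix_sum K n\<^esub> = 0"
  using hom_add[OF matrix_sum.zero_closed matrix_sum.zero_closed] by simp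

lemma hom_finsum:
  assumes "finite U" "g \<in> U \<rightarrow> carrier (matrix_sum K n)"
  shows "\<mu> (finsum (matrix_sum K n) g U) = (\<Sum>u\<in>U. \<mu> (g u))"
  using assms
proof (induction U)
  case empty
  then show ?case by (simp add: hom_zero)
next
  case (insert u U)
  then have "g \<in> U \<rightarrow> carrier (matrix_sum K n)" "g u \<in> carrier (matrix_sum K n)" by auto
  then show ?case using insert by (simp add: hom_add matrix_sum.finsum_closed)
qed

text \<open>Comparing entries, \<open>x\<close> is the combination of matrix units with its own
  entries as coefficients. Applied to the unit this gives \<open>hom_sum_diag\<close>; in general it
  identifies the image of \<open>\<mu>\<close> as a span.\<close>

lemma hom_expand:
  assumes x: "x \<in> carrier (matrix_sum K n)"
  shows "\<mu> x = (\<Sum>(j, k, l)\<in>unit_index K n. x j $$ (k, l) *\<^sub>C \<mu> (matrix_unit K n j k l))"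
proof -
  let ?g = "\<lambda>(j, k, l). x j $$ (k, l) \<odot>\<^bsub>matrix_sum K n\<^esub> matrix_unit K n j k l"
  have smult: "c \<odot>\<^bsub>matrix_sum K n\<^esub> matrix_unit K n j k l \<in> carrier (matrix_sum K n)" for c j k l
    by (auto simp: matrix_sum_def matrix_unit_def)
  then have g: "?g \<in> unit_index K n \<rightarrow> carrier (matrix_sum K n)" by auto
  have "x = finsum (matrix_sum K n) ?g (unit_index K n)"
  proof (rule matrix_sum_eqI[OF x matrix_sum.finsum_closed[OF g]])
    fix j r c assume jrc: "j < K" "r < n j" "c < n j"
    have "finsum (matrix_sum K n) ?g (unit_index K n) j $$ (r, c) =
        (\<Sum>u\<in>unit_index K n. ?g u j $$ (r, c))"
      by (rule matrix_sum_finsum_entry[OF finite_unit_index g jrc])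
    also have "\<dots> = (\<Sum>u\<in>unit_index K n. if u = (j, r, c) then x j $$ (r, c) else 0)"
      using jrc by (intro sum.cong refl) (auto simp: matrix_sum_def matrix_unit_def split: prod.split)
    also have "\<dots> = x j $$ (r, c)" using jrc finite_unit_index by (simp add: unit_index_def)
    finally show "x j $$ (r, c) = finsum (matrix_sum K n) ?g (unit_index K n) j $$ (r, c)" by simp
  qed
  then have "\<mu> x = (\<Sum>u\<in>unit_index K n. \<mu> (?g u))"
    using hom_finsum[OF finite_unit_index g] by simp
  also have "\<dots> = (\<Sum>(j, k, l)\<in>unit_index K n. x j $$ (k, l) *\<^sub>C \<mu> (matrix_unit K n j k l))"
    by (intro sum.cong refl) (auto simp: hom_smult matrix_unit_carrier)
  finally show ?thesis .
qed

lemma hom_unit_mult: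
  assumes "j < K" "k < n j" "l < n j" "j' < K" "k' < n j'" "l' < n j'"
  shows "\<mu> (matrix_unit K n j k l) * \<mu> (matrix_unit K n j' k' l') =
    (if j = j' \<and> l = k' then \<mu> (matrix_unit K n j k l') else 0)"
proof -
  let ?y = "if j = j' \<and> l = k' then matrix_unit K n j k l' else \<zero>\<^bsub>matrix_sum K n\<^esub>"
  have eq: "matrix_unit K n j k l \<otimes>\<^bsub>matrix_sum K n\<^esub> matrix_unit K n j' k' l' = ?y"
  proof (rule matrix_sum_eqI)
    show "matrix_unit K n j k l \<otimes>\<^bsub>matrix_sum K n\<^esub> matrix_unit K n j' k' l' \<in> carrier (matrix_sum K n)"
      by (auto simp: matrix_sum_def matrix_unit_def)
    show "?y \<in> carrier (matrix_sum K n)" by (simp add: matrix_unit_carrier)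
    fix i r c assume irc: "i < K" "r < n i" "c < n i"
    have "(matrix_unit K n j k l \<otimes>\<^bsub>matrix_sum K n\<^esub> matrix_unit K n j' k' l') i $$ (r, c) =
        (\<Sum>t<n i. matrix_unit K n j k l i $$ (r, t) * matrix_unit K n j' k' l' i $$ (t, c))"
      using irc by (simp add: matrix_sum_def matrix_unit_def scalar_prod_def atLeast0LessThan)
    also have "\<dots> = (\<Sum>t<n i. if t = l then
        (if i = j \<and> r = k \<and> i = j' \<and> l = k' \<and> c = l' then 1 else 0) else 0)"
      using irc by (intro sum.cong refl) (auto simp: matrix_unit_entry)
    also have "\<dots> = (if i = j \<and> r = k \<and> i = j' \<and> l = k' \<and> c = l' then 1 else 0)"
      using assms by auto
    also have "\<dots> = ?y i $$ (r, c)"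
      using irc by (auto simp: matrix_unit_entry) (auto simp: matrix_sum_def)
    finally show "(matrix_unit K n j k l \<otimes>\<^bsub>matrix_sum K n\<^esub> matrix_unit K n j' k' l') i $$ (r, c) =
      ?y i $$ (r, c)" .
  qed
  have "\<mu> (matrix_unit K n j k l) * \<mu> (matrix_unit K n j' k' l') = \<mu> ?y"
    unfolding eq[symmetric] by (rule hom_mult[symmetric]) (rule matrix_unit_carrier)+
  also have "\<dots> = (if j = j' \<and> l = k' then \<mu> (matrix_unit K n j k l') else 0)"
    by (simp add: hom_zero)
  finally show ?thesis .
qed

lemma hom_unit_star:
  assumes "j < K" "k < n j" "l < n j"
  shows "star (\<mu> (matrix_unit K n j k l)) = \<mu> (matrix_unit K n j l k)"
proof -
  have "adj (matrix_sum K n) (matrix_unit K n j k l) = matrix_unit K n j l k"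
  proof (rule matrix_sum_eqI)
    show "adj (matrix_sum K n) (matrix_unit K n j k l) \<in> carrier (matrix_sum K n)"
      by (auto simp: matrix_sum_def matrix_unit_def mat_adjoint_def mat_of_rows_def)
    show "matrix_unit K n j l k \<in> carrier (matrix_sum K n)" by (rule matrix_unit_carrier)
    fix i r c assume irc: "i < K" "r < n i" "c < n i"
    then show "adj (matrix_sum K n) (matrix_unit K n j k l) i $$ (r, c) = matrix_unit K n j l k i $$ (r, c)"
      by (simp add: matrix_sum_def matrix_unit_def mat_adjoint_def mat_of_rows_def)
  qed
  then show ?thesis using hom_adj[OF matrix_unit_carrier, of j k l] by simp
qed

lemma hom_unit_nonzero:
  assumes inj: "inj_on \<mu> (carrier (matrix_sum K n))" and r: "j < K" "k < n j" "l < n j"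
  shows "\<mu> (matrix_unit K n j k l) \<noteq> 0"
proof
  assume "\<mu> (matrix_unit K n j k l) = 0"
  then have "matrix_unit K n j k l = \<zero>\<^bsub>matrix_sum K n\<^esub>"
    using inj_onD[OF inj _ matrix_unit_carrier matrix_sum.zero_closed] hom_zero by metis
  then have "matrix_unit K n j k l j $$ (k, l) = \<zero>\<^bsub>matrix_sum K n\<^esub> j $$ (k, l)" by simp
  then show False using r by (simp add: matrix_unit_entry) (simp add: matrix_sum_def)
qed

lemma hom_sum_diag: "(\<Sum>j<K. \<Sum>k<n j. \<mu> (matrix_unit K n j k k)) = 1"
proof -
  have "1 = (\<Sum>(j, k, l)\<in>unit_index K n. \<one>\<^bsub>matrix_sum K n\<^esub> j $$ (k, l) *\<^sub>C \<mu> (matrix_unit K n j k l))"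
    unfolding hom_one[symmetric] by (rule hom_expand) (auto simp: matrix_sum_def)
  also have "\<dots> = (\<Sum>(j, k, l)\<in>unit_index K n. if l = k then \<mu> (matrix_unit K n j k k) else 0)"
    by (intro sum.cong refl) (auto simp: unit_index_def matrix_sum_def scaleC_one)
  also have "\<dots> = (\<Sum>j<K. \<Sum>k<n j. \<Sum>l<n j. if l = k then \<mu> (matrix_unit K n j k k) else 0)"
    by (rule sum_unit_index)
  also have "\<dots> = (\<Sum>j<K. \<Sum>k<n j. \<mu> (matrix_unit K n j k k))" by simp
  finally show ?thesis by simp
qed

lemma hom_image_eq_span:
  "\<mu> ` carrier (matrix_sum K n) =
    complex_vector.span {\<mu> (matrix_unit K n j k l) | j k l. j < K \<and> k < n j \<and> l < n j}"
    (is "_ = complex_vector.span ?V")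
proof
  show "\<mu> ` carrier (matrix_sum K n) \<subseteq> complex_vector.span ?V"
  proof
    fix y assume "y \<in> \<mu> ` carrier (matrix_sum K n)"
    then obtain x where x: "x \<in> carrier (matrix_sum K n)" and y: "y = \<mu> x" by blast
    show "y \<in> complex_vector.span ?V"
      unfolding y hom_expand[OF x]
      by (intro complex_vector.span_sum)
        (auto simp: unit_index_def intro!: complex_vector.span_scale[OF complex_vector.span_base])
  qed
  have "complex_vector.subspace (\<mu> ` carrier (matrix_sum K n))"
  proof (rule complex_vector.subspaceI)
    show "0 \<in> \<mu> ` carrier (matrix_sum K n)"
      by (rule image_eqI, rule hom_zero[symmetric], rule matrix_sum.zero_closed)
  next
    fix x y assume "x \<in> \<mu> ` carrier (matrix_sum K n)" "y \<in> \<mu> ` carrier (matrix_sum K n)"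
    then obtain x' y' where x': "x' \<in> carrier (matrix_sum K n)" and y': "y' \<in> carrier (matrix_sum K n)"
      and xy: "x = \<mu> x'" "y = \<mu> y'" by blast
    show "x + y \<in> \<mu> ` carrier (matrix_sum K n)"
      unfolding xy hom_add[OF x' y', symmetric] by (rule imageI) (rule matrix_sum.a_closed[OF x' y'])
  next
    fix c x assume "x \<in> \<mu> ` carrier (matrix_sum K n)"
    then obtain x' where x': "x' \<in> carrier (matrix_sum K n)" and x: "x = \<mu> x'" by blast
    have "c \<odot>\<^bsub>matrix_sum K n\<^esub> x' \<in> carrier (matrix_sum K n)"
      using matrix_sum_carrier_mat[OF x'] by (auto simp: matrix_sum_def)
    then show "c *\<^sub>C x \<in> \<mu> ` carrier (matrix_sum K n)"
      unfolding x hom_smult[OF x', symmetric] by (rule imageI)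
  qed
  then show "complex_vector.span ?V \<subseteq> \<mu> ` carrier (matrix_sum K n)"
    using matrix_unit_carrier by (intro complex_vector.span_minimal) auto
qed

end

text \<open>Only \<open>refine\<close> needs more than matrix computations. There the set
  \<open>U\<close> of units that \<open>\<phi> i\<close> produces is rewritten as a set
  \<open>I\<close> of index triples; distinct triples give distinct units, so both index the same
  sum.\<close>

lemma matrix_unit_system_canonical:
  assumes "canonical_decomposition A K n \<phi> \<mu>"
  shows "matrix_unit_system K n (\<lambda>i j k l. \<mu> i (matrix_unit (K i) (n i) j k l))"
proof -
  have n: "\<And>i j. j < K i \<Longrightarrow> 0 < n i j"
    and \<phi>: "\<And>i u. u \<in> matrix_units (K i) (n i) \<Longrightarrow> \<exists>U \<subseteq> matrix_units (K (Suc i)) (n (Suc i)).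
          \<phi> i u = finsum (matrix_sum (K (Suc i)) (n (Suc i))) (\<lambda>w. w) U"
    and \<mu>: "\<And>i. \<mu> i \<in> unital_star_hom (matrix_sum (K i) (n i)) ambient_algebra"
    and inj: "\<And>i. inj_on (\<mu> i) (carrier (matrix_sum (K i) (n i)))"
    and \<mu>\<phi>: "\<And>i x. x \<in> carrier (matrix_sum (K i) (n i)) \<Longrightarrow> \<mu> (Suc i) (\<phi> i x) = \<mu> i x"
    using assms unfolding canonical_decomposition_def by fastforce+
  show ?thesis
  proof
    fix i j k l assume r: "j < K i" "k < n i j" "l < n i j"
    let ?K = "K (Suc i)" and ?n = "n (Suc i)"
    let ?u = "\<lambda>(j, k, l). matrix_unit ?K ?n j k l"
    have "matrix_unit (K i) (n i) j k l \<in> matrix_units (K i) (n i)"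
      using r by (auto simp: matrix_units_def block_units_def)
    then obtain U where U: "U \<subseteq> matrix_units ?K ?n"
      and \<phi>U: "\<phi> i (matrix_unit (K i) (n i) j k l) = finsum (matrix_sum ?K ?n) (\<lambda>w. w) U"
      using \<phi> by blast
    define I where "I = {t \<in> unit_index ?K ?n. ?u t \<in> U}"
    have I: "I \<subseteq> unit_index ?K ?n" by (auto simp: I_def)
    have "matrix_units ?K ?n \<subseteq> ?u ` unit_index ?K ?n"
      by (force simp: matrix_units_def block_units_def unit_index_def)
    then have U_eq: "U = ?u ` I" using U by (auto simp: I_def)
    have inj_u: "inj_on ?u I"
    proof (rule inj_onI)
      fix s t assume st: "s \<in> I" "t \<in> I" and eq: "?u s = ?u t"
      obtain j1 k1 l1 j2 k2 l2 where s: "s = (j1, k1, l1)" and t: "t = (j2, k2, l2)"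
        by (metis prod_cases3)
      \<comment> \<open>The entry at the position of the first unit is 1, which determines the
        triple of the second.\<close>
      have "?u s j1 $$ (k1, l1) = ?u t j1 $$ (k1, l1)" by (simp add: eq)
      then show "s = t" using st I unfolding s t
        by (auto simp: matrix_unit_entry unit_index_def split: if_splits)
    qed
    have finU: "finite U" unfolding U_eq using finite_subset[OF I finite_unit_index] by simp
    have "\<mu> i (matrix_unit (K i) (n i) j k l) = \<mu> (Suc i) (finsum (matrix_sum ?K ?n) (\<lambda>w. w) U)"
      using \<mu>\<phi>[OF matrix_unit_carrier, of i j k l] by (simp add: \<phi>U)
    also have "\<dots> = (\<Sum>w\<in>U. \<mu> (Suc i) w)"
      using hom_finsum[OF \<mu> finU, of "\<lambda>w. w"] U_eq matrix_unit_carrier by fastforce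
    also have "\<dots> = (\<Sum>(j', k', l')\<in>I. \<mu> (Suc i) (matrix_unit ?K ?n j' k' l'))"
      unfolding U_eq sum.reindex[OF inj_u] by (simp add: case_prod_unfold)
    finally show "\<exists>I \<subseteq> {(j, k, l). j < ?K \<and> k < ?n j \<and> l < ?n j}.
        \<mu> i (matrix_unit (K i) (n i) j k l) = (\<Sum>(j', k', l')\<in>I. \<mu> (Suc i) (matrix_unit ?K ?n j' k' l'))"
      using I by (intro exI[of _ I]) (auto simp: unit_index_def)
  qed (use n hom_unit_mult[OF \<mu>] hom_unit_star[OF \<mu>] hom_unit_nonzero[OF \<mu> inj] hom_sum_diag[OF \<mu>] in auto)
qed

theorem theorem3p1:
  fixes A D :: "'b::unital_cstar_algebra set"
  assumes "AF_action A D"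
    and "\<not> finite_dimensional A"
  shows "\<exists>b::'b. UNIV = cstar_generated {b}"
proof -
  have "unital_cstar_subalgebra A \<and> simple_cstar A \<and> unital_cstar_subalgebra D \<and>
      separable_space (top_of_set D)"
    using assms(1) unfolding AF_action_def by (elim conjE, intro conjI)
  then have A: "unital_cstar_subalgebra A" "simple_cstar A"
    and D: "unital_cstar_subalgebra D" "separable_space (top_of_set D)" by simp_all
  from assms(1) obtain K n \<phi> \<mu> where cd: "canonical_decomposition A K n \<phi> \<mu>"
    and gen: "UNIV = cstar_generated (A \<union> D)"
    and comm: "\<forall>d\<in>D. \<forall>d'\<in>cstar_generated (\<Union>i. \<Union>j<K i.
      {v \<in> \<mu> i ` block_units (K i) (n i) j. v = star v}). commutator d d' = 0"
    unfolding AF_action_def Let_def by (elim conjE exE)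
  have \<mu>: "\<mu> i \<in> unital_star_hom (matrix_sum (K i) (n i)) ambient_algebra" for i
    using cd unfolding canonical_decomposition_def by blast
  define e where "e i j k l = \<mu> i (matrix_unit (K i) (n i) j k l)" for i j k l
  interpret matrix_unit_system K n e
    using matrix_unit_system_canonical[OF cd] unfolding e_def[abs_def] .
  have "\<mu> i ` carrier (matrix_sum (K i) (n i)) = complex_vector.span (units i)" for i
    using hom_image_eq_span[OF \<mu>, of i] by (simp add: units_def e_def)
  then have "A = closure (\<Union>i. complex_vector.span (units i))"
    using cd unfolding canonical_decomposition_def by simp
  then interpret simple_AF_system K n e A
    by unfold_locales (use A assms(2) in auto)
  \<comment> \<open>Encoding a countable dense subset \<open>C\<close> of \<open>D\<close> is
    enough, because the generated C*-algebra is closed.\<close>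
  obtain C where C: "countable C" "C \<subseteq> D" "top_of_set D closure_of C = D"
    using D(2) unfolding separable_space_def by auto
  have D_closure: "D \<subseteq> closure C"
    using C(2,3) unfolding closure_of_subtopology by (auto simp: Int_absorb1)
  \<comment> \<open>\<open>from_nat_into\<close> enumerates only nonempty sets; \<open>C\<close> is
    one because \<open>1 \<in> D\<close>.\<close>
  have "C \<noteq> {}" using D_closure D(1) by (auto simp: unital_cstar_subalgebra_def)
  define d where "d = from_nat_into C"
  have d: "range d = C" using range_from_nat_into[OF \<open>C \<noteq> {}\<close> C(1)] by (simp add: d_def)
  have "d m * e i j k k = e i j k k * d m" if r: "j < K i" "k < n i j" for m i j k
  proof -
    \<comment> \<open>Diagonal units are self-adjoint, hence among the generators of
      \<open>D\<^sub>0\<close>.\<close>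
    have "e i j k k \<in> (\<Union>i. \<Union>j<K i. {v \<in> \<mu> i ` block_units (K i) (n i) j. v = star v})"
    proof (intro UN_I CollectI conjI)
      show "e i j k k \<in> \<mu> i ` block_units (K i) (n i) j"
        using r by (auto simp: e_def block_units_def)
      show "e i j k k = star (e i j k k)" using star_f[OF r] by (rule sym)
    qed (use r in auto)
    then have "commutator (d m) (e i j k k) = 0"
      using d C(2) by (intro comm[rule_format] subsetD[OF cstar_generated_superset]) auto
    then show ?thesis by (simp add: commutator_def)
  qed
  then obtain b where b: "\<And>S. cstar_subalgebra S \<Longrightarrow> b \<in> S \<Longrightarrow> A \<subseteq> S \<and> range d \<subseteq> S"
    using generated_with_commuting_sequence[of d] by blast
  have S: "cstar_subalgebra (cstar_generated {b})" by (rule cstar_subalgebra_generated)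
  have "A \<subseteq> cstar_generated {b}" "range d \<subseteq> cstar_generated {b}"
    using b[OF S] cstar_generated_superset by auto
  moreover have "D \<subseteq> cstar_generated {b}"
    using D_closure cstar_subalgebra_closure[OF S] \<open>range d \<subseteq> cstar_generated {b}\<close> d by blast
  ultimately have "cstar_generated (A \<union> D) \<subseteq> cstar_generated {b}"
    by (intro cstar_generated_minimal S) simp
  then show ?thesis using gen by blast
qed

end
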